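(* Let $D\subset\mathbb{R}^n$ be a disk. There exist two constants $C_1,C_2$ (depending on $D$) such that for every $\kappa>0$ the number $\#(\kappa,D)$ of rigid isotopy classes of pairs $(D,Z(f))$ with $Z(f)\subset\mathrm{int}(D)\subset\mathbb{R}^n$ and with $\kappa^{(2)}(f,D)\leq\kappa$ is bounded by $$\#(\kappa,D)\leq\max\left\{C_1,\ \kappa^{\left(C_2\kappa^{n+1}\right)}\right\}.$$
   Context: A disk is a closed Euclidean ball of positive radius. Here $f$ ranges over functions in $C^2(D,\mathbb{R})$ such that the equation $f=0$ is regular, and $Z(f)=\{z\in D: f(z)=0\}$. Two pairs $(D,K_0)$, $(D,K_1)$ are (rigidly) isotopic if there is a continuous family of diffeomorphisms $\varphi_t:D\to D$, $t\in[0,1]$, with $\varphi_0=\mathrm{id}_D$ and $\varphi_1(K_0)=K_1$. Moreover $$\|f\|_{C^2(D,\mathbb{R})}=\sup_{z\in D}\left(\sum_{|\alpha|\le 2}|\partial^\alpha f(z)|^2\right)^{1/2},$$ $$\delta(f,D)=\min\left\{\inf_{z\in D}\left(|f(z)|^2+|\nabla f(z)|^2\right)^{1/2},\ \inf_{z\in\partial D}\left(|f(z)|^2+|\nabla(f|_{\partial D})(z)|^2\right)^{1/2}\right\},$$ $$\kappa^{(2)}(f,D)=\frac{\|f\|_{C^2(D,\mathbb{R})}}{\delta(f,D)}.$$ *)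

theory Defs
  imports "HOL-Analysis.Analysis"
begin

text \<open>
  All derivatives are taken within the closed disk, so only the values of a function on the disk
  matter. At points of a closed ball of positive radius (boundary points included) the derivative
  within the ball is unique.
\<close>

definition C1_on :: "'a::real_normed_vector set \<Rightarrow> ('a \<Rightarrow> 'b::real_normed_vector) \<Rightarrow> bool" where
  "C1_on D f \<longleftrightarrow> (\<exists>f'. (\<forall>z\<in>D. (f has_derivative blinfun_apply (f' z)) (at z within D))
      \<and> continuous_on D f')"

definition C2_on :: "'a::real_normed_vector set \<Rightarrow> ('a \<Rightarrow> 'b::real_normed_vector) \<Rightarrow> bool" where
  "C2_on D f \<longleftrightarrow> (\<exists>f'. (\<forall>z\<in>D. (f has_derivative blinfun_apply (f' z)) (at z within D))
      \<and> C1_on D f')"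

definition partial_deriv :: "(real^'n) set \<Rightarrow> 'n \<Rightarrow> (real^'n \<Rightarrow> real) \<Rightarrow> real^'n \<Rightarrow> real" where
  "partial_deriv D i f z = frechet_derivative f (at z within D) (axis i 1)"

text \<open>
  A multi-index is a function \<open>\<alpha> :: 'n \<Rightarrow> nat\<close>. The index type carries no order, so the order in
  which the partial derivatives are applied is chosen arbitrarily; for functions of class
  \<open>C\<^sup>2\<close> and multi-indices of order at most 2 the choice is irrelevant by symmetry
  of second derivatives.
\<close>

definition multi_partial :: "(real^'n) set \<Rightarrow> ('n \<Rightarrow> nat) \<Rightarrow> (real^'n \<Rightarrow> real) \<Rightarrow> real^'n \<Rightarrow> real" where
  "multi_partial D \<alpha> f = foldr (partial_deriv D) (SOME js. \<forall>i. count_list js i = \<alpha> i) f"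

definition C2_norm :: "(real^'n) set \<Rightarrow> (real^'n \<Rightarrow> real) \<Rightarrow> real" where
  "C2_norm D f = (SUP z\<in>D. sqrt (\<Sum>\<alpha> | (\<Sum>i\<in>UNIV. \<alpha> i) \<le> 2. \<bar>multi_partial D \<alpha> f z\<bar>\<^sup>2))"

definition gradient :: "(real^'n) set \<Rightarrow> (real^'n \<Rightarrow> real) \<Rightarrow> real^'n \<Rightarrow> real^'n" where
  "gradient D f z = (\<chi> i. partial_deriv D i f z)"

text \<open>
  The gradient of the restriction of \<open>f\<close> to the sphere of centre \<open>a\<close> and radius \<open>r\<close>: the vector
  tangent to the sphere that represents the derivative of the restriction. In dimension 1 the
  sphere consists of two isolated points and this gradient is 0.
\<close>

definition sphere_gradient :: "real^'n \<Rightarrow> real \<Rightarrow> (real^'n \<Rightarrow> real) \<Rightarrow> real^'n \<Rightarrow> real^'n" where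
  "sphere_gradient a r f z =
     (THE v. v \<bullet> (z - a) = 0 \<and> (f has_derivative (\<lambda>w. v \<bullet> w)) (at z within sphere a r))"

definition zero_set :: "'a set \<Rightarrow> ('a \<Rightarrow> real) \<Rightarrow> 'a set" where
  "zero_set D f = {z \<in> D. f z = 0}"

definition regular_eq :: "real^'n \<Rightarrow> real \<Rightarrow> (real^'n \<Rightarrow> real) \<Rightarrow> bool" where
  "regular_eq a r f \<longleftrightarrow>
     (\<forall>z\<in>cball a r. f z = 0 \<longrightarrow> gradient (cball a r) f z \<noteq> 0) \<and>
     (\<forall>z\<in>sphere a r. f z = 0 \<longrightarrow> sphere_gradient a r f z \<noteq> 0)"

definition delta :: "real^'n \<Rightarrow> real \<Rightarrow> (real^'n \<Rightarrow> real) \<Rightarrow> real" where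
  "delta a r f = min
     (INF z\<in>cball a r. sqrt (\<bar>f z\<bar>\<^sup>2 + (norm (gradient (cball a r) f z))\<^sup>2))
     (INF z\<in>sphere a r. sqrt (\<bar>f z\<bar>\<^sup>2 + (norm (sphere_gradient a r f z))\<^sup>2))"

definition kappa2 :: "real^'n \<Rightarrow> real \<Rightarrow> (real^'n \<Rightarrow> real) \<Rightarrow> real" where
  "kappa2 a r f = C2_norm (cball a r) f / delta a r f"

text \<open>
  Diffeomorphisms are of class \<open>C\<^sup>1\<close> (zero sets of \<open>C\<^sup>2\<close> functions are in
  general not smooth). Continuity of a family is continuity in the \<open>C\<^sup>1\<close> topology:
  the maps and their derivatives depend jointly continuously on the parameter and the point.
\<close>

definition C1_diffeo :: "'a::real_normed_vector set \<Rightarrow> ('a \<Rightarrow> 'a) \<Rightarrow> bool" where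
  "C1_diffeo D \<phi> \<longleftrightarrow> bij_betw \<phi> D D \<and> C1_on D \<phi> \<and> C1_on D (inv_into D \<phi>)"

definition continuous_diffeo_family ::
  "'a::real_normed_vector set \<Rightarrow> (real \<Rightarrow> 'a \<Rightarrow> 'a) \<Rightarrow> bool" where
  "continuous_diffeo_family D \<phi> \<longleftrightarrow>
     (\<forall>t\<in>{0..1}. C1_diffeo D (\<phi> t)) \<and>
     continuous_on ({0..1} \<times> D) (\<lambda>(t, z). \<phi> t z) \<and>
     (\<exists>\<phi>'. (\<forall>t\<in>{0..1}. \<forall>z\<in>D. (\<phi> t has_derivative blinfun_apply (\<phi>' t z)) (at z within D)) \<and>
           continuous_on ({0..1} \<times> D) (\<lambda>(t, z). \<phi>' t z))"

text \<open>A pair \<open>(D, K)\<close> is represented by the subset \<open>K\<close> of the fixed disk \<open>D\<close>.\<close>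

definition rigid_isotopy :: "'a::real_normed_vector set \<Rightarrow> ('a set \<times> 'a set) set" where
  "rigid_isotopy D = {(K0, K1). K0 \<subseteq> D \<and> K1 \<subseteq> D \<and>
     (\<exists>\<phi>. continuous_diffeo_family D \<phi> \<and> (\<forall>z\<in>D. \<phi> 0 z = z) \<and> \<phi> 1 ` K0 = K1)}"

definition zero_sets :: "real^'n \<Rightarrow> real \<Rightarrow> real \<Rightarrow> (real^'n) set set" where
  "zero_sets a r \<kappa> = {zero_set (cball a r) f | f.
     C2_on (cball a r) f \<and> regular_eq a r f \<and>
     zero_set (cball a r) f \<subseteq> interior (cball a r) \<and> kappa2 a r f \<le> \<kappa>}"

definition isotopy_classes :: "real^'n \<Rightarrow> real \<Rightarrow> real \<Rightarrow> (real^'n) set set set" where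
  "isotopy_classes a r \<kappa> = zero_sets a r \<kappa> // rigid_isotopy (cball a r)"

lemma C1_on_cong:
  fixes f g :: "'a::real_normed_vector \<Rightarrow> 'b::real_normed_vector"
  assumes "\<And>z. z \<in> D \<Longrightarrow> f z = g z"
  shows "C1_on D f \<longleftrightarrow> C1_on D g"
proof -
  have "C1_on D k" if "C1_on D h" "\<And>z. z \<in> D \<Longrightarrow> h z = k z" for h k :: "'a \<Rightarrow> 'b"
  proof -
    from that(1) obtain h' where
      h: "\<And>z. z \<in> D \<Longrightarrow> (h has_derivative blinfun_apply (h' z)) (at z within D)"
      and c: "continuous_on D h'" by (auto simp: C1_on_def)
    have "(k has_derivative blinfun_apply (h' z)) (at z within D)" if z: "z \<in> D" for z
      by (rule has_derivative_transform[OF z _ h[OF z]])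
        (simp add: \<open>\<And>z. z \<in> D \<Longrightarrow> h z = k z\<close>)
    with c show ?thesis unfolding C1_on_def by blast
  qed
  from this[of f g] this[of g f] show ?thesis using assms by auto
qed

lemma C1_on_compose:
  fixes f g :: "'a::real_normed_vector \<Rightarrow> 'a"
  assumes f: "C1_on D f" and g: "C1_on D g" and im: "f ` D \<subseteq> D"
  shows "C1_on D (g \<circ> f)"
proof -
  from f obtain f' where f': "\<And>z. z \<in> D \<Longrightarrow> (f has_derivative blinfun_apply (f' z)) (at z within D)"
    "continuous_on D f'" by (auto simp: C1_on_def)
  from g obtain g' where g': "\<And>z. z \<in> D \<Longrightarrow> (g has_derivative blinfun_apply (g' z)) (at z within D)"
    "continuous_on D g'" by (auto simp: C1_on_def)
  have cf: "continuous_on D f"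
    by (intro has_derivative_continuous_on[of D f "\<lambda>z. blinfun_apply (f' z)"] f')
  have "((g \<circ> f) has_derivative blinfun_apply (g' (f z) o\<^sub>L f' z)) (at z within D)" if "z \<in> D" for z
  proof -
    have "(g has_derivative blinfun_apply (g' (f z))) (at (f z) within f ` D)"
      using g'(1)[of "f z"] im that has_derivative_subset by blast
    from diff_chain_within[OF f'(1)[OF that] this] show ?thesis
      by (simp only: o_def blinfun_compose.rep_eq)
  qed
  moreover have "continuous_on D (\<lambda>z. g' (f z) o\<^sub>L f' z)"
    by (rule bounded_bilinear.continuous_on[OF bounded_bilinear_blinfun_compose
          continuous_on_compose2[OF g'(2) cf im] f'(2)])
  ultimately show ?thesis unfolding C1_on_def
    by (intro exI[of _ "\<lambda>z. g' (f z) o\<^sub>L f' z"] conjI ballI)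
qed

lemma C1_on_id: "C1_on D (\<lambda>z. z)"
  unfolding C1_on_def
  by (rule exI[of _ "\<lambda>_. id_blinfun"]) auto

lemma C1_diffeo_image: "C1_diffeo D \<phi> \<Longrightarrow> \<phi> ` D = D"
  by (simp add: C1_diffeo_def bij_betw_def)

lemma C1_diffeo_id: "C1_diffeo D (\<lambda>z. z)"
proof -
  have "inv_into D (\<lambda>z. z) z = z" if "z \<in> D" for z
    using inv_into_f_f[of "\<lambda>z. z" D z] that by (simp add: inj_on_def)
  then have "C1_on D (inv_into D (\<lambda>z. z))"
    using C1_on_cong[of D "inv_into D (\<lambda>z. z)" "\<lambda>z. z"] C1_on_id by blast
  then show ?thesis
    by (simp add: C1_diffeo_def C1_on_id bij_betw_def)
qed

lemma C1_diffeo_inv: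
  assumes "C1_diffeo D \<phi>" shows "C1_diffeo D (inv_into D \<phi>)"
proof -
  have b: "bij_betw \<phi> D D" and "C1_on D \<phi>" using assms by (auto simp: C1_diffeo_def)
  have "inv_into D (inv_into D \<phi>) z = \<phi> z" if "z \<in> D" for z
    using inv_into_inv_into_eq[OF b that] .
  then show ?thesis
    using assms C1_on_cong[of D "inv_into D (inv_into D \<phi>)" \<phi>]
    by (auto simp: C1_diffeo_def bij_betw_inv_into)
qed

lemma C1_diffeo_compose:
  assumes f: "C1_diffeo D f" and g: "C1_diffeo D g" shows "C1_diffeo D (g \<circ> f)"
proof -
  have bf: "bij_betw f D D" and bg: "bij_betw g D D" using assms by (auto simp: C1_diffeo_def)
  have b: "bij_betw (g \<circ> f) D D" using bf bg by (rule bij_betw_trans)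
  have "inv_into D (g \<circ> f) z = (inv_into D f \<circ> inv_into D g) z" if "z \<in> D" for z
    using bf bg that by (intro inv_into_comp[of g f D, simplified bij_betw_imp_surj_on[OF bf]])
      (auto simp: bij_betw_def)
  moreover have "C1_on D (inv_into D f \<circ> inv_into D g)"
    using C1_diffeo_inv[OF f] C1_diffeo_inv[OF g]
    by (intro C1_on_compose) (auto simp: C1_diffeo_def bij_betw_def)
  ultimately have "C1_on D (inv_into D (g \<circ> f))"
    using C1_on_cong[of D "inv_into D (g \<circ> f)"] by blast
  moreover have "C1_on D (g \<circ> f)"
    using assms by (intro C1_on_compose) (auto simp: C1_diffeo_def bij_betw_def)
  ultimately show ?thesis using b by (simp add: C1_diffeo_def)
qed

lemma continuous_diffeo_family_const:
  assumes "C1_diffeo D f" shows "continuous_diffeo_family D (\<lambda>_. f)"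
proof -
  from assms obtain f' where f': "\<And>z. z \<in> D \<Longrightarrow> (f has_derivative blinfun_apply (f' z)) (at z within D)"
    "continuous_on D f'" by (auto simp: C1_diffeo_def C1_on_def)
  have cf: "continuous_on D f"
    by (intro has_derivative_continuous_on[of D f "\<lambda>z. blinfun_apply (f' z)"] f')
  have "continuous_on ({0..1::real} \<times> D) (\<lambda>p. f (snd p))"
    by (rule continuous_on_compose2[OF cf]) (auto intro!: continuous_intros)
  moreover have "continuous_on ({0..1::real} \<times> D) (\<lambda>p. f' (snd p))"
    by (rule continuous_on_compose2[OF f'(2)]) (auto intro!: continuous_intros)
  ultimately show ?thesis
    using assms f'(1) unfolding continuous_diffeo_family_def
    by (intro conjI exI[of _ "\<lambda>_. f'"]) (auto simp: case_prod_beta')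
qed

lemma continuous_diffeo_family_reverse:
  assumes "continuous_diffeo_family D \<phi>"
  shows "continuous_diffeo_family D (\<lambda>t. \<phi> (1 - t))"
proof -
  from assms obtain \<phi>' where
    d: "\<And>t. t \<in> {0..1} \<Longrightarrow> C1_diffeo D (\<phi> t)"
    and c: "continuous_on ({0..1} \<times> D) (\<lambda>(t, z). \<phi> t z)"
    and h: "\<And>t z. t \<in> {0..1} \<Longrightarrow> z \<in> D \<Longrightarrow> (\<phi> t has_derivative blinfun_apply (\<phi>' t z)) (at z within D)"
    and c': "continuous_on ({0..1} \<times> D) (\<lambda>(t, z). \<phi>' t z)"
    unfolding continuous_diffeo_family_def by blast
  have r: "continuous_on ({0..1::real} \<times> D) (\<lambda>p. (1 - fst p, snd p))"
    by (intro continuous_intros)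
  have "continuous_on ({0..1} \<times> D) (\<lambda>p. (\<lambda>(t, z). \<phi> t z) (1 - fst p, snd p))"
    by (rule continuous_on_compose2[OF c r]) auto
  moreover have "continuous_on ({0..1} \<times> D) (\<lambda>p. (\<lambda>(t, z). \<phi>' t z) (1 - fst p, snd p))"
    by (rule continuous_on_compose2[OF c' r]) auto
  ultimately show ?thesis
    using d h unfolding continuous_diffeo_family_def
    by (intro conjI exI[of _ "\<lambda>t. \<phi>' (1 - t)"]) (auto simp: case_prod_beta')
qed

lemma continuous_diffeo_family_compose:
  assumes "continuous_diffeo_family D \<phi>" "continuous_diffeo_family D \<psi>"
  shows "continuous_diffeo_family D (\<lambda>t. \<psi> t \<circ> \<phi> t)"
proof -
  from assms(1) obtain \<phi>' where
    d: "\<And>t. t \<in> {0..1} \<Longrightarrow> C1_diffeo D (\<phi> t)"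
    and c: "continuous_on ({0..1} \<times> D) (\<lambda>(t, z). \<phi> t z)"
    and h: "\<And>t z. t \<in> {0..1} \<Longrightarrow> z \<in> D \<Longrightarrow> (\<phi> t has_derivative blinfun_apply (\<phi>' t z)) (at z within D)"
    and c': "continuous_on ({0..1} \<times> D) (\<lambda>(t, z). \<phi>' t z)"
    unfolding continuous_diffeo_family_def by blast
  from assms(2) obtain \<psi>' where
    e: "\<And>t. t \<in> {0..1} \<Longrightarrow> C1_diffeo D (\<psi> t)"
    and k: "continuous_on ({0..1} \<times> D) (\<lambda>(t, z). \<psi> t z)"
    and g: "\<And>t z. t \<in> {0..1} \<Longrightarrow> z \<in> D \<Longrightarrow> (\<psi> t has_derivative blinfun_apply (\<psi>' t z)) (at z within D)"
    and k': "continuous_on ({0..1} \<times> D) (\<lambda>(t, z). \<psi>' t z)"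
    unfolding continuous_diffeo_family_def by blast
  have im: "\<phi> t z \<in> D" if "t \<in> {0..1}" "z \<in> D" for t z
    using C1_diffeo_image[OF d[OF that(1)]] that(2) by blast
  have r: "continuous_on ({0..1} \<times> D) (\<lambda>p. (fst p, \<phi> (fst p) (snd p)))"
    using c by (intro continuous_intros) (simp add: case_prod_beta')
  have ri: "(\<lambda>p. (fst p, \<phi> (fst p) (snd p))) ` ({0..1} \<times> D) \<subseteq> {0..1} \<times> D"
    using im by auto
  have "continuous_on ({0..1} \<times> D) (\<lambda>p. (\<lambda>(t, z). \<psi> t z) (fst p, \<phi> (fst p) (snd p)))"
    by (rule continuous_on_compose2[OF k r ri])
  then have 1: "continuous_on ({0..1} \<times> D) (\<lambda>(t, z). (\<psi> t \<circ> \<phi> t) z)"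
    by (simp add: case_prod_beta')
  have "continuous_on ({0..1} \<times> D) (\<lambda>p. (\<lambda>(t, z). \<psi>' t z) (fst p, \<phi> (fst p) (snd p)))"
    by (rule continuous_on_compose2[OF k' r ri])
  from bounded_bilinear.continuous_on[OF bounded_bilinear_blinfun_compose this c']
  have 2: "continuous_on ({0..1} \<times> D) (\<lambda>(t, z). \<psi>' t (\<phi> t z) o\<^sub>L \<phi>' t z)"
    by (simp add: case_prod_beta')
  have 3: "((\<psi> t \<circ> \<phi> t) has_derivative blinfun_apply (\<psi>' t (\<phi> t z) o\<^sub>L \<phi>' t z)) (at z within D)"
    if "t \<in> {0..1}" "z \<in> D" for t z
  proof -
    have "(\<psi> t has_derivative blinfun_apply (\<psi>' t (\<phi> t z))) (at (\<phi> t z) within \<phi> t ` D)"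
      using g[OF that(1) im[OF that]] C1_diffeo_image[OF d[OF that(1)]] by simp
    from diff_chain_within[OF h[OF that] this] show ?thesis
      by (simp only: o_def blinfun_compose.rep_eq)
  qed
  have 4: "C1_diffeo D (\<psi> t \<circ> \<phi> t)" if "t \<in> {0..1}" for t
    by (rule C1_diffeo_compose[OF d[OF that] e[OF that]])
  show ?thesis
    unfolding continuous_diffeo_family_def using 1 2 3 4
    by (intro conjI exI[of _ "\<lambda>t z. \<psi>' t (\<phi> t z) o\<^sub>L \<phi>' t z"] ballI)
qed

lemma equiv_rigid_isotopy: "equiv (Pow D) (rigid_isotopy D)"
proof (rule equivI)
  show "rigid_isotopy D \<subseteq> Pow D \<times> Pow D"
    by (auto simp: rigid_isotopy_def)
  show "refl_on (Pow D) (rigid_isotopy D)"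
    using continuous_diffeo_family_const[OF C1_diffeo_id[of D]]
    by (auto simp: refl_on_def rigid_isotopy_def intro!: exI[of _ "\<lambda>_ z. z"])
  show "sym (rigid_isotopy D)"
  proof (rule symI)
    fix K0 K1 assume "(K0, K1) \<in> rigid_isotopy D"
    then obtain \<phi> where K: "K0 \<subseteq> D" "K1 \<subseteq> D" and \<phi>: "continuous_diffeo_family D \<phi>"
      and 0: "\<And>z. z \<in> D \<Longrightarrow> \<phi> 0 z = z" and 1: "\<phi> 1 ` K0 = K1"
      by (auto simp: rigid_isotopy_def)
    let ?i = "inv_into D (\<phi> 1)"
    have d: "C1_diffeo D (\<phi> 1)" using \<phi> by (auto simp: continuous_diffeo_family_def)
    have b: "bij_betw (\<phi> 1) D D" using d by (simp add: C1_diffeo_def)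
    have iD: "?i z \<in> D" and fi: "\<phi> 1 (?i z) = z" if "z \<in> D" for z
      using b that by (auto simp: bij_betw_def intro: inv_into_into f_inv_into_f)
    have "continuous_diffeo_family D (\<lambda>t. \<phi> (1 - t) \<circ> ?i)"
      by (intro continuous_diffeo_family_compose continuous_diffeo_family_const
          continuous_diffeo_family_reverse \<phi> C1_diffeo_inv d)
    moreover have "(\<phi> (1 - 0) \<circ> ?i) z = z" if "z \<in> D" for z using fi[OF that] by simp
    moreover have "(\<phi> (1 - 1) \<circ> ?i) ` K1 = K0"
    proof -
      have "(\<phi> (1 - 1) \<circ> ?i) z = ?i z" if "z \<in> K1" for z
        using 0[OF iD] that K(2) by auto
      then have "(\<phi> (1 - 1) \<circ> ?i) ` K1 = ?i ` \<phi> 1 ` K0" using 1 by (auto simp: image_iff)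
      also have "\<dots> = K0"
        using b K(1) by (intro inv_into_image_cancel) (auto simp: bij_betw_def)
      finally show ?thesis .
    qed
    ultimately show "(K1, K0) \<in> rigid_isotopy D"
      using K unfolding rigid_isotopy_def by blast
  qed
  show "trans (rigid_isotopy D)"
  proof (rule transI)
    fix K0 K1 K2 assume "(K0, K1) \<in> rigid_isotopy D" "(K1, K2) \<in> rigid_isotopy D"
    then obtain \<phi> \<psi> where K: "K0 \<subseteq> D" "K2 \<subseteq> D"
      and \<phi>: "continuous_diffeo_family D \<phi>" "\<And>z. z \<in> D \<Longrightarrow> \<phi> 0 z = z" "\<phi> 1 ` K0 = K1"
      and \<psi>: "continuous_diffeo_family D \<psi>" "\<And>z. z \<in> D \<Longrightarrow> \<psi> 0 z = z" "\<psi> 1 ` K1 = K2"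
      by (auto simp: rigid_isotopy_def)
    have "continuous_diffeo_family D (\<lambda>t. \<psi> t \<circ> \<phi> t)"
      by (intro continuous_diffeo_family_compose \<phi>(1) \<psi>(1))
    moreover have "(\<psi> 0 \<circ> \<phi> 0) z = z" if "z \<in> D" for z
      using \<phi>(2) \<psi>(2) that by simp
    moreover have "(\<psi> 1 \<circ> \<phi> 1) ` K0 = K2"
      using \<phi>(3) \<psi>(3) by (simp only: image_comp [symmetric])
    ultimately show "(K0, K2) \<in> rigid_isotopy D"
      using K unfolding rigid_isotopy_def by blast
  qed
qed

end

theory Submission
  imports Defs
begin

text \<open>
  Dividing \<open>f\<close> by a multiple of its \<open>C\<^sup>2\<close> norm gives an equation \<open>F = 0\<close> with gradient \<open>G\<close> for which
  \<open>F\<close>, \<open>G\<close> and the derivative of \<open>G\<close> are bounded by 1 and \<open>F\<^sup>2 + \<bar>G\<bar>\<^sup>2 \<ge> d\<^sup>2\<close>, where \<open>d\<close> is proportional to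
  \<open>1 / \<kappa>\<close>; also \<open>\<bar>F\<bar> \<ge> d\<close> on the sphere, because a minimum of \<open>\<bar>F\<bar>\<close> there is a critical point of the
  restriction. The natural length scale of such an equation is \<open>d\<close>: if the values of two of them
  differ by at most a small multiple of \<open>d\<^sup>2\<close> and their gradients by a small multiple of \<open>d\<close>, moving
  every point along \<open>G\<close> until \<open>F\<close> has changed by a prescribed cut-off difference is a
  \<open>C\<^sup>1\<close>-small perturbation of the identity, hence a rigid isotopy between the zero sets. Rounding
  values and gradients on a grid of mesh proportional to \<open>d\<close> decides closeness in this sense, so the
  number of classes is at most the number of roundings, which is \<open>\<kappa>\<close> to the power
  \<open>O(\<kappa>\<^sup>n)\<close>.
\<close>

section \<open>Implicit functions and perturbations of the identity\<close>

text \<open>The tolerances \<open>d\<^sup>2\<close> for values and \<open>d\<close> for gradients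
  come from the geometry. Where \<open>F\<close> is small, \<open>G\<close> is only known to have
  length at least \<open>d / 2\<close>; being 1-Lipschitz, it may turn round over a length of order
  \<open>d\<close>. So motion along \<open>G z\<close> is under control over a fraction of
  \<open>d\<close>, and on such a piece \<open>F\<close> is only sure to change by a multiple of
  \<open>d\<^sup>2\<close>.

  Regularity shapes the construction: \<open>F\<close> is only of class C2, so \<open>G\<close> may
  be differentiated once, and the isotopy has to be C1. Points therefore move on straight lines by a
  length that is defined implicitly; its derivative contains \<open>G'\<close> and nothing beyond. A
  cut-off is unavoidable, since away from the zeros \<open>G\<close> may vanish.

  Derivatives are taken within a closed disk. The lower bound for \<open>F\<close> on the sphere
  keeps all moving points away from it, so boundary points matter only in translating the hypotheses
  and in inverting the final maps. The constants of the isotopy argument are free of the dimension,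
  which enters through the normalisation and the grid.\<close>

lemma has_derivative_inverse_within_lipschitz:
  fixes f :: "'a::real_normed_vector \<Rightarrow> 'b::real_normed_vector"
  assumes f: "(f has_derivative f') (at (g y) within S)" and g': "bounded_linear g'"
    and inv: "\<And>x. g' (f' x) = x"
    and gS: "\<And>z. z \<in> T \<Longrightarrow> g z \<in> S" and fg: "\<And>z. z \<in> T \<Longrightarrow> f (g z) = z"
    and lip: "\<And>z. z \<in> T \<Longrightarrow> norm (g z - g y) \<le> K * norm (z - y)" and y: "y \<in> T"
  shows "(g has_derivative g') (at y within T)"
  unfolding has_derivative_within_alt
proof (intro conjI g' allI impI)
  fix e :: real assume e: "e > 0"
  interpret g': bounded_linear g' by fact
  obtain C where C: "0 < C" "\<And>x. norm (g' x) \<le> norm x * C"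
    using bounded_linear.pos_bounded[OF g'] by blast
  define k where "k = max K 1"
  have k: "k \<ge> 1" "\<And>z. z \<in> T \<Longrightarrow> norm (g z - g y) \<le> k * norm (z - y)"
  proof -
    show "norm (g z - g y) \<le> k * norm (z - y)" if "z \<in> T" for z
      using lip[OF that] mult_right_mono[of K k "norm (z - y)"] by (simp add: k_def)
  qed (simp add: k_def)
  have "e / (C * k) > 0" using e C(1) k(1) by simp
  then obtain d where d: "d > 0"
    "\<And>x. x \<in> S \<Longrightarrow> norm (x - g y) < d \<Longrightarrow>
      norm (f x - f (g y) - f' (x - g y)) \<le> e / (C * k) * norm (x - g y)"
    using f unfolding has_derivative_within_alt by blast
  show "\<exists>d>0. \<forall>z\<in>T. norm (z - y) < d \<longrightarrow> norm (g z - g y - g' (z - y)) \<le> e * norm (z - y)"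
  proof (intro exI[of _ "d / k"] conjI ballI impI)
    show "d / k > 0" using d k by simp
    fix z assume z: "z \<in> T" "norm (z - y) < d / k"
    have "k * norm (z - y) < d" using z(2) k by (simp add: field_simps)
    then have "norm (g z - g y) < d" using k(2)[OF z(1)] by linarith
    from d(2)[OF gS[OF z(1)] this] have
      1: "norm (z - y - f' (g z - g y)) \<le> e / (C * k) * norm (g z - g y)"
      by (simp add: fg z y)
    \<comment> \<open>The left inverse \<open>g'\<close> carries the remainder of \<open>f\<close>
      at \<open>g y\<close> over to a remainder of \<open>g\<close> at \<open>y\<close>; the
      Lipschitz bound then turns \<open>norm (g z - g y)\<close> into
      \<open>norm (z - y)\<close>.\<close>
    have "g z - g y - g' (z - y) = - g' (z - y - f' (g z - g y))"
      by (simp add: g'.diff inv)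
    then have "norm (g z - g y - g' (z - y)) \<le> norm (z - y - f' (g z - g y)) * C"
      using C(2) by simp
    also have "\<dots> \<le> (e / (C * k) * norm (g z - g y)) * C"
      using mult_right_mono[OF 1, of C] C(1) by simp
    also have "\<dots> = e / k * norm (g z - g y)" using C by simp
    also have "\<dots> \<le> e / k * (k * norm (z - y))"
      using k e z by (intro mult_left_mono) auto
    finally show "norm (g z - g y - g' (z - y)) \<le> e * norm (z - y)" using k by simp
  qed
qed

text \<open>Along the graph \<open>H\<close> is constant, so its linear part is small relative to
  \<open>norm h + \<bar>k\<bar>\<close>, where \<open>k\<close> is the increment of
  \<open>s\<close>. Continuity of \<open>s\<close> only places the graph in the region where this
  holds; the estimate itself then forces \<open>k\<close> to be of the order of
  \<open>h\<close>.\<close>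

lemma implicit_function_has_derivative:
  fixes H :: "'a::real_normed_vector \<times> real \<Rightarrow> real"
  assumes H: "(H has_derivative H') (at (z, s z) within S \<times> UNIV)" and b: "H' (0, 1) \<noteq> 0"
    and s: "continuous (at z within S) s" and eq: "\<And>x. x \<in> S \<Longrightarrow> H (x, s x) = c" and z: "z \<in> S"
  shows "(s has_derivative (\<lambda>h. - H' (h, 0) / H' (0, 1))) (at z within S)"
  unfolding has_derivative_within_alt
proof (intro conjI allI impI)
  interpret H': bounded_linear H' using H by (rule has_derivative_bounded_linear)
  let ?b = "H' (0, 1)" and ?A = "\<lambda>h. H' (h, 0) / H' (0, 1)"
  have pair: "bounded_linear (\<lambda>h::'a. (h, 0::real))"
    by (intro bounded_linear_Pair bounded_linear_ident bounded_linear_zero)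
  have A: "bounded_linear ?A"
    using bounded_linear_divide bounded_linear_compose[OF H'.bounded_linear_axioms pair]
    by (rule bounded_linear_compose)
  then show "bounded_linear (\<lambda>h. - H' (h, 0) / H' (0, 1))"
    using bounded_linear_minus[OF A] by simp
  obtain C where C: "0 < C" "\<And>x. norm (?A x) \<le> norm x * C"
    using bounded_linear.pos_bounded[OF A] by blast
  fix e :: real assume e: "e > 0"
  \<comment> \<open>The bound 1/2 lets the share of \<open>\<bar>k\<bar>\<close> be absorbed, which
    gives \<open>\<bar>k\<bar> \<le> (2 * C + 1) * norm h\<close>; the other bound then reduces the
    remainder to \<open>e * norm h\<close>.\<close>
  define \<epsilon> where "\<epsilon> = min (1/2) (e / (2 * C + 2))"
  have \<epsilon>: "\<epsilon> > 0" "\<epsilon> \<le> 1/2" using e C(1) by (auto simp: \<epsilon>_def min_def)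
  have "\<epsilon> \<le> e / (2 * C + 2)" by (simp add: \<epsilon>_def)
  then have \<epsilon>e: "\<epsilon> * (2 * C + 2) \<le> e" using C(1) by (simp only: pos_le_divide_eq)
  have "\<epsilon> * \<bar>?b\<bar> > 0" using \<epsilon> b by simp
  then obtain d where d: "d > 0"
    "\<And>p. p \<in> S \<times> UNIV \<Longrightarrow> norm (p - (z, s z)) < d \<Longrightarrow>
      norm (H p - H (z, s z) - H' (p - (z, s z))) \<le> \<epsilon> * \<bar>?b\<bar> * norm (p - (z, s z))"
    using H unfolding has_derivative_within_alt by blast
  obtain d' where d': "d' > 0" "\<And>x. x \<in> S \<Longrightarrow> dist x z < d' \<Longrightarrow> dist (s x) (s z) < d / 2"
    using s d unfolding continuous_within_eps_delta by (metis half_gt_zero)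
  show "\<exists>d>0. \<forall>x\<in>S. norm (x - z) < d \<longrightarrow>
    norm (s x - s z - - H' (x - z, 0) / H' (0, 1)) \<le> e * norm (x - z)"
  proof (intro exI[of _ "min (d / 2) d'"] conjI ballI impI)
    show "min (d / 2) d' > 0" using d d' by simp
    fix x assume x: "x \<in> S" "norm (x - z) < min (d / 2) d'"
    define h k where "h = x - z" and "k = s x - s z"
    have np: "norm (h, k) \<le> norm h + \<bar>k\<bar>" using norm_Pair_le[of h k] by simp
    have "norm h + \<bar>k\<bar> < d"
      using x d'(2)[OF x(1)] by (simp add: h_def k_def dist_norm)
    then have "norm ((x, s x) - (z, s z)) < d" using np by (simp add: h_def k_def)
    from d(2)[OF _ this] have "\<bar>H' (h, k)\<bar> \<le> \<epsilon> * \<bar>?b\<bar> * norm (h, k)"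
      using x(1) z by (simp add: eq h_def k_def)
    also have "H' (h, k) = ?b * (k + ?A h)"
    proof -
      have "(h, k) = (h, 0) + k *\<^sub>R (0, 1)" by simp
      then have "H' (h, k) = H' (h, 0) + k * ?b" by (simp only: H'.add H'.scaleR) simp
      then show ?thesis using b by (simp add: field_simps)
    qed
    finally have "\<bar>?b\<bar> * \<bar>k + ?A h\<bar> \<le> \<bar>?b\<bar> * (\<epsilon> * norm (h, k))" by (simp add: abs_mult mult_ac)
    then have "\<bar>k + ?A h\<bar> \<le> \<epsilon> * norm (h, k)" using b by (simp del: times_divide_eq_right)
    also have "\<dots> \<le> \<epsilon> * (norm h + \<bar>k\<bar>)" using np \<epsilon> by (intro mult_left_mono) auto
    finally have 1: "\<bar>k + ?A h\<bar> \<le> \<epsilon> * (norm h + \<bar>k\<bar>)" .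
    have "\<epsilon> * (norm h + \<bar>k\<bar>) \<le> 1/2 * (norm h + \<bar>k\<bar>)" using \<epsilon> by (intro mult_right_mono) auto
    then have 2: "2 * \<bar>k + ?A h\<bar> \<le> norm h + \<bar>k\<bar>" using order_trans[OF 1] by fastforce
    have 3: "\<bar>?A h\<bar> \<le> norm h * C" using C(2)[of h] by (simp only: real_norm_def)
    have 4: "\<bar>k\<bar> \<le> \<bar>k + ?A h\<bar> + \<bar>?A h\<bar>" by linarith
    have "x \<le> 2 * m + n" if "x \<le> y + u" "2 * y \<le> n + x" "u \<le> m" for x y u m n :: real
      using that by linarith
    from this[OF 4 2 3] have "\<bar>k\<bar> \<le> (2 * C + 1) * norm h" by (simp add: algebra_simps)
    then have "\<epsilon> * (norm h + \<bar>k\<bar>) \<le> \<epsilon> * ((2 * C + 2) * norm h)"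
      using \<epsilon> by (intro mult_left_mono) (auto simp: algebra_simps)
    also have "\<dots> \<le> e * norm h" using mult_right_mono[OF \<epsilon>e, of "norm h"] by (simp add: mult_ac)
    finally show "norm (s x - s z - - H' (x - z, 0) / H' (0, 1)) \<le> e * norm (x - z)"
      using 1 by (simp add: h_def k_def)
  qed
qed

lemma segment_crosses_sphere:
  fixes a x y :: "'a::euclidean_space"
  assumes "x \<in> cball a r" "y \<notin> ball a r"
  obtains p where "p \<in> sphere a r" "p \<in> closed_segment x y"
proof (cases "x \<in> ball a r")
  case True
  then have "closed_segment x y \<inter> frontier (ball a r) \<noteq> {}"
    using assms by (intro connected_Int_frontier) auto
  moreover have "frontier (ball a r) = sphere a r"
    using True by (intro frontier_ball) (metis ball_eq_empty empty_iff not_le)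
  ultimately show ?thesis using that by blast
next
  case False
  then have "x \<in> sphere a r" using assms by auto
  then show ?thesis using that by auto
qed

text \<open>The disk is preserved because the perturbed identity is a bijection of the whole space,
  by Banach's fixed point theorem, and leaves every point outside \<open>D\<close> in place.
  Smallness of \<open>w'\<close> makes the derivative invertible with inverse of norm at most 2, so
  the inverse map is C1 up to the boundary.\<close>

lemma C1_diffeo_small_perturbation:
  fixes a :: "'a::euclidean_space" and r :: real and w :: "'a \<Rightarrow> 'a"
  defines "D \<equiv> cball a r"
  assumes w: "\<And>z. z \<in> D \<Longrightarrow> (w has_derivative blinfun_apply (w' z)) (at z within D)"
    and w': "continuous_on D w'" and bound: "\<And>z. z \<in> D \<Longrightarrow> norm (w' z) \<le> 1/2"
    and sphere: "\<And>z. z \<in> sphere a r \<Longrightarrow> w z = 0"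
  shows "C1_diffeo D (\<lambda>z. z + w z)"
proof -
  let ?\<phi> = "\<lambda>z. z + w z"
  \<comment> \<open>Since \<open>w\<close> vanishes on the sphere, its extension by 0 is still a contraction, and it fixes the complement of \<open>D\<close>.\<close>
  define W where "W z = (if z \<in> D then w z else 0)" for z
  have lipD: "norm (w x - w y) \<le> 1/2 * norm (x - y)" if "x \<in> D" "y \<in> D" for x y
    by (rule differentiable_bound[OF _ w _ that])
      (use bound in \<open>auto simp: D_def norm_blinfun.rep_eq[symmetric]\<close>)
  have lip0: "norm (w x) \<le> 1/2 * norm (x - y)" if x: "x \<in> D" and y: "y \<notin> D" for x y
  proof -
    obtain p where p: "p \<in> sphere a r" "p \<in> closed_segment x y"
      using segment_crosses_sphere[of x a r y] x y by (auto simp: D_def)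
    have "norm (w x) = norm (w x - w p)" using sphere p by simp
    also have "\<dots> \<le> 1/2 * norm (x - p)" using p x by (intro lipD) (auto simp: D_def)
    also have "norm (x - p) \<le> norm (x - y)"
      using dist_in_closed_segment[OF p(2)] by (simp add: dist_norm norm_minus_commute)
    finally show ?thesis by simp
  qed
  have lip: "norm (W x - W y) \<le> 1/2 * norm (x - y)" for x y
    using lipD[of x y] lip0[of x y] lip0[of y x] by (auto simp: W_def norm_minus_commute)
  have expand: "norm (x - y) \<le> 2 * norm ((x + W x) - (y + W y))" for x y
  proof -
    have "norm (x - y) \<le> norm ((x + W x) - (y + W y)) + norm (W x - W y)"
      using norm_triangle_ineq4[of "(x + W x) - (y + W y)" "W x - W y"] by simp
    then show ?thesis using lip[of x y] by linarith
  qed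
  have surj: "\<exists>z. z + W z = y" for y
  proof -
    have "\<exists>!z. y - W z = z"
    proof (rule banach_fix_type[of "1/2"], simp, simp, intro allI)
      fix u v
      have "norm ((y - W u) - (y - W v)) = norm (W v - W u)" by simp
      also have "\<dots> \<le> 1/2 * norm (v - u)" by (rule lip)
      finally show "dist (y - W u) (y - W v) \<le> 1/2 * dist u v"
        by (simp only: dist_norm norm_minus_commute)
    qed
    then show ?thesis by (metis diff_eq_eq)
  qed
  have W_out: "W z = 0" if "z \<notin> D" for z using that by (simp add: W_def)
  have W_in: "W z = w z" if "z \<in> D" for z using that by (simp add: W_def)
  \<comment> \<open>A point of \<open>D\<close> sent outside would share its image with the fixed
    point \<open>?\<phi> z\<close>, against injectivity.\<close>
  have into: "?\<phi> z \<in> D" if z: "z \<in> D" for z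
  proof (rule ccontr)
    assume n: "?\<phi> z \<notin> D"
    then have "norm (z - ?\<phi> z) \<le> 2 * norm ((z + W z) - (?\<phi> z + W (?\<phi> z)))" by (intro expand)
    also have "\<dots> = 0" using n z by (simp add: W_out W_in)
    finally show False using n z by simp
  qed
  have inj: "inj_on ?\<phi> D"
  proof (rule inj_onI)
    fix x y assume "x \<in> D" "y \<in> D" "?\<phi> x = ?\<phi> y"
    then show "x = y" using expand[of x y] by (simp add: W_in)
  qed
  have onto: "\<exists>z\<in>D. ?\<phi> z = y" if y: "y \<in> D" for y
  proof -
    obtain z where z: "z + W z = y" using surj by blast
    then have "z \<in> D" using y W_out by (cases "z \<in> D") auto
    with z show ?thesis by (auto simp: W_in)
  qed
  have bij: "bij_betw ?\<phi> D D" unfolding bij_betw_def using inj into onto by blast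
  define \<phi>' where "\<phi>' z = id_blinfun + w' z" for z
  have d\<phi>: "(?\<phi> has_derivative blinfun_apply (\<phi>' z)) (at z within D)" if "z \<in> D" for z
    using that unfolding \<phi>'_def by (auto intro!: derivative_eq_intros w simp: blinfun.add_left)
  have c\<phi>': "continuous_on D \<phi>'" unfolding \<phi>'_def by (intro continuous_intros w')
  have exp': "norm h \<le> 2 * norm (\<phi>' z h)" if "z \<in> D" for z h
  proof -
    have "norm (w' z h) \<le> 1/2 * norm h"
      using norm_blinfun[of "w' z" h] mult_right_mono[OF bound[OF that], of "norm h"] by simp
    then show ?thesis
      using norm_triangle_ineq2[of h "- w' z h"] by (simp add: \<phi>'_def blinfun.add_left)
  qed
  have "\<exists>B. \<forall>h. blinfun_apply B (\<phi>' z h) = h \<and> \<phi>' z (blinfun_apply B h) = h" if "z \<in> D" for z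
  proof -
    have "linear (\<phi>' z)" by (rule bounded_linear.linear[OF blinfun.bounded_linear_right])
    moreover have "inj (\<phi>' z)"
    proof (rule injI)
      fix x y assume "\<phi>' z x = \<phi>' z y"
      then show "x = y" using exp'[OF that, of "x - y"] by (simp add: blinfun.diff_right)
    qed
    ultimately obtain g where g: "linear g" "\<And>x. g (\<phi>' z x) = x" "\<And>x. \<phi>' z (g x) = x"
      using linear_injective_isomorphism[of "\<phi>' z"] by auto
    then have "blinfun_apply (Blinfun g) = g"
      by (intro bounded_linear_Blinfun_apply linear_conv_bounded_linear[THEN iffD1])
    with g show ?thesis by (intro exI[of _ "Blinfun g"]) auto
  qed
  then obtain B where B: "\<And>z h. z \<in> D \<Longrightarrow> blinfun_apply (B z) (\<phi>' z h) = h"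
    "\<And>z h. z \<in> D \<Longrightarrow> \<phi>' z (blinfun_apply (B z) h) = h" by metis
  have nB: "norm (B z) \<le> 2" if "z \<in> D" for z
    by (rule norm_blinfun_bound) (use exp'[OF that, of "B z h" for h] B that in auto)
  have Bdiff: "norm (B x - B y) \<le> 4 * norm (\<phi>' y - \<phi>' x)" if "x \<in> D" "y \<in> D" for x y
  proof -
    \<comment> \<open>Resolvent identity: inversion is Lipschitz where the inverses are bounded,
      which gives continuity of \<open>B\<close>.\<close>
    have "B x - B y = B x o\<^sub>L (\<phi>' y - \<phi>' x) o\<^sub>L B y"
      by (rule blinfun_eqI) (simp add: blinfun.diff_left blinfun.diff_right B that)
    also have "norm \<dots> \<le> norm (B x o\<^sub>L (\<phi>' y - \<phi>' x)) * norm (B y)"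
      by (rule norm_blinfun_compose)
    also have "\<dots> \<le> (norm (B x) * norm (\<phi>' y - \<phi>' x)) * norm (B y)"
      by (intro mult_right_mono norm_blinfun_compose) auto
    also have "\<dots> \<le> (2 * norm (\<phi>' y - \<phi>' x)) * 2"
      by (intro mult_mono nB that) auto
    finally show ?thesis by simp
  qed
  have cB: "continuous_on D B"
    unfolding continuous_on_def
  proof
    fix x assume x: "x \<in> D"
    have "((\<lambda>y. 4 * norm (\<phi>' x - \<phi>' y)) \<longlongrightarrow> 4 * norm (\<phi>' x - \<phi>' x)) (at x within D)"
      using c\<phi>' x unfolding continuous_on_def by (intro tendsto_intros) auto
    then have "((\<lambda>y. B y - B x) \<longlongrightarrow> 0) (at x within D)"
      by (intro Lim_null_comparison[of "\<lambda>y. B y - B x" "\<lambda>y. 4 * norm (\<phi>' x - \<phi>' y)"])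
        (auto simp: eventually_at_filter x intro!: always_eventually Bdiff)
    then show "(B \<longlongrightarrow> B x) (at x within D)" by (simp add: LIM_zero_iff)
  qed
  let ?q = "inv_into D ?\<phi>"
  have qD: "?q y \<in> D" and \<phi>q: "?\<phi> (?q y) = y" if "y \<in> D" for y
    using bij_betw_imp_surj_on[OF bij] that by (auto intro: inv_into_into f_inv_into_f)
  have lipq: "norm (?q x - ?q y) \<le> 2 * norm (x - y)" if "x \<in> D" "y \<in> D" for x y
    using expand[of "?q x" "?q y"] \<phi>q qD that by (simp add: W_in)
  have dq: "(?q has_derivative blinfun_apply (B (?q y))) (at y within D)" if y: "y \<in> D" for y
  proof (rule has_derivative_inverse_within_lipschitz[where S = D and K = 2])
    show "(?\<phi> has_derivative blinfun_apply (\<phi>' (?q y))) (at (?q y) within D)"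
      by (rule d\<phi>[OF qD[OF y]])
    show "bounded_linear (blinfun_apply (B (?q y)))" by (rule blinfun.bounded_linear_right)
    show "B (?q y) (\<phi>' (?q y) h) = h" for h by (rule B(1)[OF qD[OF y]])
    show "norm (?q x - ?q y) \<le> 2 * norm (x - y)" if "x \<in> D" for x by (rule lipq[OF that y])
  qed (fact qD \<phi>q y)+
  have cq: "continuous_on D ?q"
    by (rule has_derivative_continuous_on[of D ?q "\<lambda>y. blinfun_apply (B (?q y))"]) (rule dq)
  have cBq: "continuous_on D (\<lambda>y. B (?q y))"
    by (rule continuous_on_compose2[OF cB cq]) (rule image_subsetI, rule qD)
  have "C1_on D ?q" unfolding C1_on_def
    by (rule exI[of _ "\<lambda>y. B (?q y)"]) (intro conjI ballI dq cBq)
  moreover have "C1_on D ?\<phi>" unfolding C1_on_def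
    by (rule exI[of _ \<phi>']) (intro conjI ballI d\<phi> c\<phi>')
  ultimately show ?thesis using bij by (simp add: C1_diffeo_def)
qed

section \<open>Isotopy of close equations\<close>

text \<open>Gradient and second derivative are carried along as a vector field and a field of
  bounded operators, so every bound is coordinate-free. The sphere enters only through the size of
  \<open>F\<close>; the tangential gradient has been eliminated.\<close>

definition normalised ::
  "'a::euclidean_space \<Rightarrow> real \<Rightarrow> real \<Rightarrow> ('a \<Rightarrow> real) \<Rightarrow> ('a \<Rightarrow> 'a) \<Rightarrow> ('a \<Rightarrow> 'a \<Rightarrow>\<^sub>L 'a) \<Rightarrow> bool" where
  "normalised a r d F G G' \<longleftrightarrow>
     (\<forall>z\<in>cball a r. (F has_derivative (\<lambda>h. G z \<bullet> h)) (at z within cball a r) \<and>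
        (G has_derivative blinfun_apply (G' z)) (at z within cball a r) \<and>
        \<bar>F z\<bar> \<le> 1 \<and> norm (G z) \<le> 1 \<and> norm (G' z) \<le> 1 \<and> d\<^sup>2 \<le> (F z)\<^sup>2 + (norm (G z))\<^sup>2) \<and>
     continuous_on (cball a r) G' \<and> (\<forall>z\<in>sphere a r. d \<le> \<bar>F z\<bar>)"

lemma normalised_lipschitz:
  assumes "normalised a r d F G G'" "x \<in> cball a r" "y \<in> cball a r"
  shows "\<bar>F x - F y\<bar> \<le> norm (x - y)" "norm (G x - G y) \<le> norm (x - y)"
proof -
  have "onorm (\<lambda>h. G z \<bullet> h) \<le> 1" if "z \<in> cball a r" for z
  proof (rule onorm_le)
    fix h
    have "norm (G z) \<le> 1" using assms(1) that by (auto simp: normalised_def)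
    from order_trans[OF Cauchy_Schwarz_ineq2 mult_right_mono[OF this norm_ge_zero]]
    show "norm (G z \<bullet> h) \<le> 1 * norm h" by simp
  qed
  then have "norm (F x - F y) \<le> 1 * norm (x - y)"
    using assms by (intro differentiable_bound[where S = "cball a r" and f' = "\<lambda>z h. G z \<bullet> h"])
      (auto simp: normalised_def)
  then show "\<bar>F x - F y\<bar> \<le> norm (x - y)" by simp
  have "norm (G x - G y) \<le> 1 * norm (x - y)"
    using assms by (intro differentiable_bound[where S = "cball a r" and f' = "\<lambda>z. blinfun_apply (G' z)"])
      (auto simp: normalised_def norm_blinfun.rep_eq[symmetric])
  then show "norm (G x - G y) \<le> norm (x - y)" by simp
qed

section \<open>A continuously differentiable bump function\<close>

lemma has_real_derivative_max_0_power2: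
  "((\<lambda>y::real. (max 0 y)\<^sup>2) has_real_derivative 2 * max 0 y) (at y)"
proof -
  consider "y > 0" | "y < 0" | "y = 0" by linarith
  then show ?thesis
  proof cases
    case 1
    have "((\<lambda>y::real. y\<^sup>2) has_real_derivative 2 * max 0 y) (at y)"
      using 1 by (auto intro!: derivative_eq_intros)
    then show ?thesis
      by (rule has_field_derivative_transform_within_open[where S = "{0<..}"]) (use 1 in auto)
  next
    case 2
    have "((\<lambda>y::real. 0) has_real_derivative 2 * max 0 y) (at y)"
      using 2 by (auto intro!: derivative_eq_intros)
    then show ?thesis
      by (rule has_field_derivative_transform_within_open[where S = "{..<0}"]) (use 2 in auto)
  next
    case 3
    have "((\<lambda>h. ((max 0 (0 + h))\<^sup>2 - (max 0 (0::real))\<^sup>2) / h) \<longlongrightarrow> 0) (at 0)"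
    proof (rule Lim_null_comparison)
      show "eventually (\<lambda>h::real. norm (((max 0 (0 + h))\<^sup>2 - (max 0 0)\<^sup>2) / h) \<le> \<bar>h\<bar>) (at 0)"
        by (intro always_eventually allI) (auto simp: max_def power2_eq_square)
      show "((\<lambda>h::real. \<bar>h\<bar>) \<longlongrightarrow> 0) (at 0)" by (intro tendsto_rabs_zero) simp
    qed
    then show ?thesis using 3 by (simp add: DERIV_def)
  qed
qed

text \<open>Truncating the parabola leaves a kink at \<open>\<bar>x\<bar> = \<eta>\<close>, which
  the outer square removes: a C1 function with support between \<open>-\<eta>\<close> and
  \<open>\<eta>\<close>, a polynomial there, without a plateau at 0.\<close>

definition cutoff :: "real \<Rightarrow> real \<Rightarrow> real" where
  "cutoff \<eta> x = (max 0 (1 - (x / \<eta>)\<^sup>2))\<^sup>2"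

definition cutoff_deriv :: "real \<Rightarrow> real \<Rightarrow> real" where
  "cutoff_deriv \<eta> x = - 4 * x / \<eta>\<^sup>2 * max 0 (1 - (x / \<eta>)\<^sup>2)"

lemma cutoff_has_derivative:
  "(cutoff \<eta> has_real_derivative cutoff_deriv \<eta> x) (at x)"
proof -
  have "((\<lambda>x. 1 - (x / \<eta>)\<^sup>2) has_real_derivative - 2 * x / \<eta>\<^sup>2) (at x)"
    by (cases "\<eta> = 0") (auto intro!: derivative_eq_intros simp: power2_eq_square)
  from DERIV_chain2[OF has_real_derivative_max_0_power2 this] show ?thesis
    by (simp add: cutoff_def[abs_def] cutoff_deriv_def mult_ac)
qed

lemma cutoff_bounds: "0 \<le> cutoff \<eta> x" "cutoff \<eta> x \<le> 1"
  by (auto simp: cutoff_def max_def power_le_one)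

lemma cutoff_eq_0:
  assumes "\<eta> > 0" "\<eta> \<le> \<bar>x\<bar>"
  shows "cutoff \<eta> x = 0" "cutoff_deriv \<eta> x = 0"
proof -
  have "1\<^sup>2 \<le> \<bar>x / \<eta>\<bar>\<^sup>2" using assms by (intro power_mono) auto
  then have "max 0 (1 - (x / \<eta>)\<^sup>2) = 0" unfolding power2_abs by simp
  then show "cutoff \<eta> x = 0" "cutoff_deriv \<eta> x = 0"
    unfolding cutoff_def cutoff_deriv_def by simp_all
qed

lemma cutoff_deriv_bound:
  assumes "\<eta> > 0"
  shows "\<bar>cutoff_deriv \<eta> x\<bar> \<le> 4 / \<eta>"
proof (cases "\<bar>x\<bar> < \<eta>")
  case True
  have "\<bar>cutoff_deriv \<eta> x\<bar> = 4 / \<eta>\<^sup>2 * (\<bar>x\<bar> * \<bar>max 0 (1 - (x / \<eta>)\<^sup>2)\<bar>)"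
    by (simp add: cutoff_deriv_def abs_mult)
  also have "\<dots> \<le> 4 / \<eta>\<^sup>2 * (\<eta> * 1)"
    using True assms by (intro mult_left_mono mult_mono) (auto simp: max_def)
  finally show ?thesis using assms by (simp add: power2_eq_square)
qed (use assms cutoff_eq_0[of \<eta> x] in auto)

text \<open>In the absence of a plateau, this linear rate of approach to 1 is what excludes spurious
  zeros of the modified equation.\<close>

lemma cutoff_near_0:
  assumes "\<eta> > 0"
  shows "1 - cutoff \<eta> x \<le> 2 * \<bar>x\<bar> / \<eta>"
proof (cases "\<bar>x\<bar> < \<eta>")
  case True
  define q where "q = \<bar>x\<bar> / \<eta>"
  have q: "0 \<le> q" "q \<le> 1" "(x / \<eta>)\<^sup>2 = q\<^sup>2" using True assms by (auto simp: q_def power_divide)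
  have "q * q \<le> q * 1" using q by (intro mult_left_mono)
  then have "q\<^sup>2 \<le> q" by (simp add: power2_eq_square)
  then have "cutoff \<eta> x = (1 - q\<^sup>2)\<^sup>2" using q by (simp add: cutoff_def)
  also have "\<dots> = 1 - 2 * q\<^sup>2 + (q\<^sup>2)\<^sup>2" by (simp add: power2_diff)
  finally have "1 - cutoff \<eta> x \<le> 2 * q\<^sup>2" by simp
  then show ?thesis using \<open>q\<^sup>2 \<le> q\<close> by (simp add: q_def)
next
  case False
  then have "1 \<le> \<bar>x\<bar> / \<eta>" using assms by simp
  then show ?thesis using cutoff_bounds(1)[of \<eta> x] by simp
qed

text \<open>The isotopy moves \<open>z\<close> along the line through \<open>z\<close> with direction \<open>G z\<close>, on which \<open>F\<close> is
  monotone near \<open>z\<close> as long as \<open>\<bar>F z\<bar> < d / 2\<close>.\<close>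

locale close_equations =
  fixes a :: "'a::euclidean_space" and r d :: real
    and F g :: "'a \<Rightarrow> real" and G \<Gamma> :: "'a \<Rightarrow> 'a" and G' \<Gamma>' :: "'a \<Rightarrow> 'a \<Rightarrow>\<^sub>L 'a"
  assumes r: "r > 0" and d: "d > 0"
    and F: "normalised a r d F G G'" and g: "normalised a r d g \<Gamma> \<Gamma>'"
    and close: "\<And>z. z \<in> cball a r \<Longrightarrow> \<bar>g z - F z\<bar> \<le> d\<^sup>2 / 400"
      "\<And>z. z \<in> cball a r \<Longrightarrow> norm (\<Gamma> z - G z) \<le> d / 400"
begin

abbreviation "D \<equiv> cball a r"

lemma F_deriv: "z \<in> D \<Longrightarrow> (F has_derivative (\<lambda>h. G z \<bullet> h)) (at z within D)"
  and G_deriv: "z \<in> D \<Longrightarrow> (G has_derivative blinfun_apply (G' z)) (at z within D)"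
  and g_deriv: "z \<in> D \<Longrightarrow> (g has_derivative (\<lambda>h. \<Gamma> z \<bullet> h)) (at z within D)"
  and F_bound: "z \<in> D \<Longrightarrow> \<bar>F z\<bar> \<le> 1"
  and \<Gamma>_bound: "z \<in> D \<Longrightarrow> norm (\<Gamma> z) \<le> 1" and G'_bound: "z \<in> D \<Longrightarrow> norm (G' z) \<le> 1"
  and F_regular: "z \<in> D \<Longrightarrow> d\<^sup>2 \<le> (F z)\<^sup>2 + (norm (G z))\<^sup>2"
  and G'_cont: "continuous_on D G'" and F_sphere: "z \<in> sphere a r \<Longrightarrow> d \<le> \<bar>F z\<bar>"
  using F g by (auto simp: normalised_def)

lemmas F_lip = normalised_lipschitz(1)[OF F] and G_lip = normalised_lipschitz(2)[OF F]

lemma F_cont: "continuous_on D F"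
  by (rule has_derivative_continuous_on[where f' = "\<lambda>z h. G z \<bullet> h"]) (rule F_deriv)

lemma g_cont: "continuous_on D g"
  by (rule has_derivative_continuous_on[where f' = "\<lambda>z h. \<Gamma> z \<bullet> h"]) (rule g_deriv)

lemma G_cont: "continuous_on D G"
  by (rule has_derivative_continuous_on[where f' = "\<lambda>z. blinfun_apply (G' z)"]) (rule G_deriv)

lemma \<Gamma>_cont: "continuous_on D \<Gamma>"
  by (rule has_derivative_continuous_on[where f' = "\<lambda>z. blinfun_apply (\<Gamma>' z)"])
    (use g in \<open>auto simp: normalised_def\<close>)

text \<open>At a point of the sphere the lower bound \<open>d\<close> for
  \<open>\<bar>F\<bar>\<close> meets the upper bound 1. This permits comparing the tolerance
  \<open>d\<^sup>2 / 400\<close> with multiples of \<open>d\<close>.\<close>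

lemma d_le_1: "d \<le> 1"
proof -
  obtain b :: 'a where "b \<in> Basis" by fastforce
  then have "a + r *\<^sub>R b \<in> sphere a r" using r by (simp add: dist_norm)
  from F_sphere[OF this] F_bound[of "a + r *\<^sub>R b"] this show ?thesis by auto
qed

lemma d2_le: "d\<^sup>2 \<le> d"
  using d d_le_1 by (simp add: power2_eq_square mult_left_le)

text \<open>\<open>U\<close> and \<open>V\<close> are relatively open and cover the disk. The implicit equation is solved on \<open>U\<close>; on
  \<open>V\<close> the cut-off vanishes, so nothing moves, and no gluing along a closed set is needed.\<close>

definition U where "U = {z \<in> D. \<bar>g z\<bar> < d / 4}"
definition V where "V = {z \<in> D. d / 8 < \<bar>g z\<bar>}"

lemma D_eq: "D = U \<union> V"
  using d by (auto simp: U_def V_def)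

lemma U_D: "z \<in> U \<Longrightarrow> z \<in> D" by (simp add: U_def)

lemma U_F: assumes "z \<in> U" shows "\<bar>F z\<bar> < d / 2"
proof -
  have "\<bar>g z - F z\<bar> \<le> d / 400" using close(1)[of z] d2_le assms by (auto simp: U_def)
  moreover have "\<bar>F z\<bar> \<le> \<bar>g z\<bar> + \<bar>g z - F z\<bar>" by linarith
  moreover have "\<bar>g z\<bar> < d / 4" using assms by (simp add: U_def)
  ultimately show ?thesis using d by (simp add: field_simps)
qed

lemma U_G: assumes "z \<in> U" shows "d / 2 \<le> norm (G z)"
proof -
  have "(F z)\<^sup>2 \<le> (d / 2)\<^sup>2" using U_F[OF assms] d by (intro abs_le_square_iff[THEN iffD1]) auto
  then have "4 * (F z)\<^sup>2 \<le> d\<^sup>2" by (simp add: power_divide)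
  moreover have "d\<^sup>2 \<le> (F z)\<^sup>2 + (norm (G z))\<^sup>2" by (rule F_regular[OF U_D[OF assms]])
  ultimately have "d\<^sup>2 \<le> 4 * (norm (G z))\<^sup>2" using zero_le_power2[of d] by linarith
  then have "(d / 2)\<^sup>2 \<le> (norm (G z))\<^sup>2" by (simp add: power_divide)
  then show ?thesis by (rule power2_le_imp_le) simp
qed

text \<open>\<open>F\<close> is 1-Lipschitz, smaller than \<open>d / 2\<close> in absolute value at
  \<open>z\<close> and at least \<open>d\<close> on the sphere, so \<open>U\<close> stays
  \<open>d / 2\<close> away from the sphere. Hence points move only in the interior, where
  derivatives within the disk are ordinary derivatives.\<close>

lemma U_near: assumes z: "z \<in> U" and y: "norm (y - z) < d / 2" shows "y \<in> ball a r"
proof (rule ccontr)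
  assume "y \<notin> ball a r"
  then obtain p where p: "p \<in> sphere a r" "p \<in> closed_segment z y"
    using segment_crosses_sphere[OF U_D[OF z]] by blast
  have "norm (p - z) \<le> norm (y - z)"
    using dist_in_closed_segment[OF p(2)] by (simp add: dist_norm norm_minus_commute)
  moreover have "\<bar>F p - F z\<bar> \<le> norm (p - z)" using p(1) U_D[OF z] by (intro F_lip) auto
  ultimately have "\<bar>F p - F z\<bar> < d / 2" using y by simp
  with U_F[OF z] have "\<bar>F z\<bar> + \<bar>F p - F z\<bar> < d / 2 + d / 2" by (rule add_strict_mono)
  moreover have "\<bar>F p\<bar> \<le> \<bar>F z\<bar> + \<bar>F p - F z\<bar>" by arith
  ultimately show False using F_sphere[OF p(1)] by simp
qed

lemma U_ball: "z \<in> U \<Longrightarrow> z \<in> ball a r"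
  using U_near[of z z] d by simp

lemma open_U: "open U"
proof -
  have "U = {z \<in> ball a r. \<bar>g z\<bar> < d / 4}"
  proof (rule set_eqI)
    show "z \<in> U \<longleftrightarrow> z \<in> {z \<in> ball a r. \<bar>g z\<bar> < d / 4}" for z
      using U_ball[of z] by (auto simp: U_def)
  qed
  also have "\<dots> = ball a r \<inter> (\<lambda>z. \<bar>g z\<bar>) -` {..< d / 4}" by auto
  also have "open \<dots>"
    by (intro continuous_open_preimage continuous_intros continuous_on_subset[OF g_cont]) auto
  finally show ?thesis .
qed

lemma at_ball: "z \<in> ball a r \<Longrightarrow> at z within D = at z"
  by (intro at_within_interior) simp

section \<open>Monotonicity of \<open>F\<close> along the lines with direction
  \<open>G z\<close>\<close>

definition valid where "valid z s \<longleftrightarrow> \<bar>s\<bar> * norm (G z) \<le> d / 4"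

lemma valid_ball: "z \<in> U \<Longrightarrow> valid z s \<Longrightarrow> z + s *\<^sub>R G z \<in> ball a r"
  using d by (intro U_near[of z]) (auto simp: valid_def)

text \<open>The displacement \<open>\<bar>s\<bar> * norm (G z)\<close> is at most half of
  \<open>norm (G z)\<close>, because \<open>norm (G z) \<ge> d / 2\<close> on \<open>U\<close>. The
  1-Lipschitz field \<open>G\<close> therefore changes by at most half of that length and keeps at
  least half of its component along \<open>G z\<close>.\<close>

lemma valid_G:
  assumes "z \<in> U" "valid z s"
  shows "norm (G (z + s *\<^sub>R G z) - G z) \<le> \<bar>s\<bar> * norm (G z)"
    "(norm (G z))\<^sup>2 / 2 \<le> G (z + s *\<^sub>R G z) \<bullet> G z" "norm (G (z + s *\<^sub>R G z)) \<le> 3/2 * norm (G z)"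
proof -
  show 1: "norm (G (z + s *\<^sub>R G z) - G z) \<le> \<bar>s\<bar> * norm (G z)"
    using G_lip[of "z + s *\<^sub>R G z" z] valid_ball[OF assms] U_D[OF assms(1)] by simp
  then have 2: "norm (G (z + s *\<^sub>R G z) - G z) \<le> norm (G z) / 2"
    using assms U_G[of z] by (auto simp: valid_def)
  then show "norm (G (z + s *\<^sub>R G z)) \<le> 3/2 * norm (G z)"
    using norm_triangle_ineq2[of "G (z + s *\<^sub>R G z)" "G z"] by linarith
  have "- ((G (z + s *\<^sub>R G z) - G z) \<bullet> G z) \<le> norm (G z) / 2 * norm (G z)"
    using Cauchy_Schwarz_ineq2[of "G (z + s *\<^sub>R G z) - G z" "G z"]
      mult_right_mono[OF 2, of "norm (G z)"] by simp
  moreover have "G (z + s *\<^sub>R G z) \<bullet> G z = (norm (G z))\<^sup>2 + (G (z + s *\<^sub>R G z) - G z) \<bullet> G z"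
    by (simp add: inner_diff_left power2_norm_eq_inner)
  ultimately show "(norm (G z))\<^sup>2 / 2 \<le> G (z + s *\<^sub>R G z) \<bullet> G z"
    by (simp add: power2_eq_square)
qed

lemma F_along_line:
  assumes "z \<in> U" "valid z s"
  shows "((\<lambda>s. F (z + s *\<^sub>R G z)) has_real_derivative G (z + s *\<^sub>R G z) \<bullet> G z) (at s)"
proof -
  let ?y = "z + s *\<^sub>R G z"
  have "(F has_derivative (\<lambda>h. G ?y \<bullet> h)) (at ?y)"
    using F_deriv[of ?y] at_ball[of ?y] valid_ball[OF assms] by auto
  moreover have "((\<lambda>s. z + s *\<^sub>R G z) has_derivative (\<lambda>h. h *\<^sub>R G z)) (at s)"
    by (auto intro!: derivative_eq_intros)
  ultimately have "((\<lambda>s. F (z + s *\<^sub>R G z)) has_derivative (\<lambda>h. G ?y \<bullet> (h *\<^sub>R G z))) (at s)"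
    by (rule has_derivative_compose[rotated])
  then show ?thesis unfolding has_field_derivative_def
    by (rule has_derivative_eq_rhs) (simp add: fun_eq_iff)
qed

lemma F_line_increasing:
  assumes "z \<in> U" "valid z s" "valid z s'" "s \<le> s'"
  shows "(s' - s) * ((norm (G z))\<^sup>2 / 2) \<le> F (z + s' *\<^sub>R G z) - F (z + s *\<^sub>R G z)"
proof -
  have "valid z x" if "s \<le> x" "x \<le> s'" for x
  proof -
    have "\<bar>x\<bar> \<le> max \<bar>s\<bar> \<bar>s'\<bar>" using that by auto
    then have "\<bar>x\<bar> * norm (G z) \<le> max \<bar>s\<bar> \<bar>s'\<bar> * norm (G z)" by (rule mult_right_mono) simp
    also have "\<dots> \<le> d / 4" using assms(2,3) by (auto simp: valid_def max_def)
    finally show ?thesis by (simp add: valid_def)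
  qed
  then have val: "valid z x" if "s \<le> x" "x \<le> s'" for x using that by blast
  have "\<exists>D'. DERIV (\<lambda>x. F (z + x *\<^sub>R G z) - x * ((norm (G z))\<^sup>2 / 2)) x :> D' \<and> 0 \<le> D'"
    if x: "s \<le> x" "x \<le> s'" for x
  proof (intro exI conjI)
    show "DERIV (\<lambda>x. F (z + x *\<^sub>R G z) - x * ((norm (G z))\<^sup>2 / 2)) x
        :> G (z + x *\<^sub>R G z) \<bullet> G z - 1 * ((norm (G z))\<^sup>2 / 2)"
      by (intro DERIV_diff F_along_line assms(1) val x DERIV_cmult_right DERIV_ident)
    show "0 \<le> G (z + x *\<^sub>R G z) \<bullet> G z - 1 * ((norm (G z))\<^sup>2 / 2)"
      using valid_G(2)[OF assms(1) val[OF x]] by simp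
  qed
  from DERIV_nonneg_imp_nondecreasing[OF assms(4) this]
  have "F (z + s *\<^sub>R G z) - s * ((norm (G z))\<^sup>2 / 2) \<le> F (z + s' *\<^sub>R G z) - s' * ((norm (G z))\<^sup>2 / 2)"
    by simp
  moreover have "(s' - s) * c \<le> y - x" if "x - s * c \<le> y - s' * c" for x y c
    using that by (simp add: algebra_simps)
  ultimately show ?thesis by blast
qed

text \<open>A quantitative injectivity along the line: it yields both the uniqueness and the
  continuity of the implicit solution.\<close>

lemma F_line_expanding:
  assumes "z \<in> U" "valid z s" "valid z s'"
  shows "\<bar>s' - s\<bar> * (d\<^sup>2 / 8) \<le> \<bar>F (z + s' *\<^sub>R G z) - F (z + s *\<^sub>R G z)\<bar>"
proof -
  have "(d / 2)\<^sup>2 \<le> (norm (G z))\<^sup>2" using U_G[OF assms(1)] d by (intro power_mono) auto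
  then have "\<bar>s' - s\<bar> * (d\<^sup>2 / 8) \<le> \<bar>s' - s\<bar> * ((norm (G z))\<^sup>2 / 2)"
    by (intro mult_left_mono) (auto simp: power_divide)
  also have "\<dots> \<le> \<bar>F (z + s' *\<^sub>R G z) - F (z + s *\<^sub>R G z)\<bar>"
  proof (cases "s \<le> s'")
    case True
    then have "\<bar>s' - s\<bar> = s' - s" by simp
    then show ?thesis using order_trans[OF F_line_increasing[OF assms True] abs_ge_self] by simp
  next
    case False
    then have "\<bar>s' - s\<bar> = s - s'" "s' \<le> s" by simp_all
    then show ?thesis
      using order_trans[OF F_line_increasing[OF assms(1,3,2)] abs_ge_self]
      by (simp add: abs_minus_commute)
  qed
  finally show ?thesis .
qed

lemma F_line_solvable:
  assumes z: "z \<in> U" and c: "\<bar>c\<bar> \<le> d\<^sup>2 / 400"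
  obtains s where "\<bar>s\<bar> * norm (G z) \<le> d / 100" "F (z + s *\<^sub>R G z) = F z + c"
proof -
  define m where "m = norm (G z)"
  have m: "d / 2 \<le> m" "m > 0"
    using U_G[OF z] less_le_trans[OF half_gt_zero[OF d] U_G[OF z]] by (simp_all only: m_def)
  \<comment> \<open>Chosen so that the guaranteed growth \<open>b * (m\<^sup>2 / 2)\<close> equals
    the tolerance \<open>d\<^sup>2 / 400\<close>; the intermediate value theorem on
    \<open>{- b..b}\<close> then reaches every admissible \<open>c\<close>.\<close>
  define b where "b = d\<^sup>2 / (200 * m\<^sup>2)"
  have b: "b > 0" using m d by (simp add: b_def)
  have bm: "b * m \<le> d / 100"
  proof -
    have "b * m = d * (d / (200 * m))" using m by (simp add: b_def power2_eq_square)
    also have "\<dots> \<le> d * (1 / 100)" using m d by (intro mult_left_mono) (simp_all add: pos_divide_le_eq)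
    finally show ?thesis by simp
  qed
  have val: "valid z s" if "\<bar>s\<bar> \<le> b" for s
  proof -
    have "\<bar>s\<bar> * m \<le> b * m" using that m by (intro mult_right_mono) auto
    then show ?thesis using bm d by (simp add: valid_def m_def)
  qed
  have e: "b * (m\<^sup>2 / 2) = d\<^sup>2 / 400" using m by (simp add: b_def)
  have "b * (m\<^sup>2 / 2) \<le> F (z + b *\<^sub>R G z) - F z"
    "b * (m\<^sup>2 / 2) \<le> F z - F (z + (- b) *\<^sub>R G z)"
    using F_line_increasing[OF z val val, of 0 b] F_line_increasing[OF z val val, of "- b" 0] b(1)
    unfolding m_def by simp_all
  then have "F z + d\<^sup>2 / 400 \<le> F (z + b *\<^sub>R G z)" "F (z + (- b) *\<^sub>R G z) \<le> F z - d\<^sup>2 / 400"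
    unfolding e by simp_all
  then have "F (z + (- b) *\<^sub>R G z) \<le> F z + c" "F z + c \<le> F (z + b *\<^sub>R G z)" using c by auto
  moreover have "continuous_on {- b..b} (\<lambda>s. F (z + s *\<^sub>R G z))"
    by (intro continuous_at_imp_continuous_on ballI DERIV_isCont[OF F_along_line[OF z val]]) auto
  ultimately obtain s where "- b \<le> s" "s \<le> b" "F (z + s *\<^sub>R G z) = F z + c"
    using IVT'[of "\<lambda>s. F (z + s *\<^sub>R G z)" "- b" "F z + c" b] b(1) by auto
  moreover have "\<bar>s\<bar> * norm (G z) \<le> d / 100"
  proof -
    have "\<bar>s\<bar> * m \<le> b * m" using \<open>- b \<le> s\<close> \<open>s \<le> b\<close> m(2) by (intro mult_right_mono) auto
    then show ?thesis using bm by (simp add: m_def)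
  qed
  ultimately show ?thesis using that by blast
qed

text \<open>The cut-off depends on \<open>g\<close> rather than on \<open>F\<close>, so that \<open>F + \<tau>\<close> has exactly the zeros of \<open>g\<close> although the
  cut-off equals 1 only at 0.\<close>

definition \<tau> where "\<tau> z = cutoff (d / 8) (g z) * (g z - F z)"
definition T where "T z = (cutoff_deriv (d / 8) (g z) * (g z - F z)) *\<^sub>R \<Gamma> z + cutoff (d / 8) (g z) *\<^sub>R (\<Gamma> z - G z)"

lemma \<tau>_bound: assumes "z \<in> D" shows "\<bar>\<tau> z\<bar> \<le> d\<^sup>2 / 400"
proof -
  have "\<bar>\<tau> z\<bar> \<le> 1 * (d\<^sup>2 / 400)"
    unfolding \<tau>_def abs_mult using close(1)[OF assms] cutoff_bounds by (intro mult_mono) auto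
  then show ?thesis by simp
qed

text \<open>With cut-off width \<open>d / 8\<close> the derivative of the cut-off is at most
  \<open>32 / d\<close>; multiplied by the value difference \<open>d\<^sup>2 / 400\<close> it is of
  order \<open>d\<close>, like the gradient difference. \<open>T\<close> is the gradient of
  \<open>\<tau>\<close>.\<close>

lemma T_bound: assumes "z \<in> D" shows "norm (T z) \<le> 33 * d / 400"
proof -
  have "\<bar>cutoff_deriv (d / 8) (g z) * (g z - F z)\<bar> \<le> 4 / (d / 8) * (d\<^sup>2 / 400)"
    unfolding abs_mult using close(1)[OF assms] cutoff_deriv_bound[of "d / 8"] d by (intro mult_mono) auto
  also have "\<dots> = 32 * d / 400" using d by (simp add: power2_eq_square)
  finally have "norm ((cutoff_deriv (d / 8) (g z) * (g z - F z)) *\<^sub>R \<Gamma> z) \<le> 32 * d / 400 * 1"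
    unfolding norm_scaleR using \<Gamma>_bound[OF assms] d by (intro mult_mono) auto
  moreover have "norm (cutoff (d / 8) (g z) *\<^sub>R (\<Gamma> z - G z)) \<le> 1 * (d / 400)"
    unfolding norm_scaleR using close(2)[OF assms] cutoff_bounds by (intro mult_mono) auto
  ultimately have "norm (T z) \<le> 32 * d / 400 * 1 + 1 * (d / 400)"
    unfolding T_def by (intro norm_triangle_mono)
  then show ?thesis by simp
qed

lemma \<tau>_deriv: assumes "z \<in> D" shows "(\<tau> has_derivative (\<lambda>h. T z \<bullet> h)) (at z within D)"
proof -
  have "((\<lambda>z. cutoff (d / 8) (g z)) has_derivative (\<lambda>h. (\<Gamma> z \<bullet> h) * cutoff_deriv (d / 8) (g z))) (at z within D)"
    using has_derivative_compose[OF g_deriv[OF assms] cutoff_has_derivative[unfolded has_field_derivative_def]]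
    by (simp add: mult.commute)
  from has_derivative_mult[OF this has_derivative_diff[OF g_deriv F_deriv, OF assms assms]]
  have "(\<tau> has_derivative (\<lambda>h. cutoff (d / 8) (g z) * (\<Gamma> z \<bullet> h - G z \<bullet> h)
      + (\<Gamma> z \<bullet> h) * cutoff_deriv (d / 8) (g z) * (g z - F z))) (at z within D)"
    unfolding \<tau>_def[abs_def] .
  then show ?thesis
    by (rule has_derivative_eq_rhs) (simp add: T_def fun_eq_iff inner_add_left inner_diff_left)
qed

lemma \<tau>_V: "z \<in> V \<Longrightarrow> \<tau> z = 0" "z \<in> V \<Longrightarrow> T z = 0"
  using d by (auto simp: V_def \<tau>_def T_def cutoff_eq_0)

section \<open>The implicitly defined displacement\<close>

definition sol :: "real \<Rightarrow> 'a \<Rightarrow> real" where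
  "sol t z = (THE s. valid z s \<and> F (z + s *\<^sub>R G z) = F z + t * \<tau> z)"

lemma sol_unique:
  assumes "z \<in> U" "valid z s" "valid z s'" "F (z + s *\<^sub>R G z) = F (z + s' *\<^sub>R G z)"
  shows "s' = s"
proof -
  have "\<bar>s' - s\<bar> * (d\<^sup>2 / 8) \<le> 0" using F_line_expanding[OF assms(1-3)] assms(4) by simp
  then show ?thesis using d by (simp add: mult_le_0_iff)
qed

text \<open>Uniqueness, which gives \<open>THE\<close> its meaning, is available only among valid
  displacements. The solution found is much shorter than \<open>valid\<close> demands,
  \<open>d / 100\<close> against \<open>d / 4\<close>; the slack keeps the same \<open>s\<close>
  valid at nearby points when continuity is proved.\<close>

lemma sol:
  assumes z: "z \<in> U" and t: "t \<in> {0..1}"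
  shows "\<bar>sol t z\<bar> * norm (G z) \<le> d / 100" "valid z (sol t z)"
    "F (z + sol t z *\<^sub>R G z) = F z + t * \<tau> z"
proof -
  have "\<bar>t * \<tau> z\<bar> \<le> 1 * (d\<^sup>2 / 400)"
    unfolding abs_mult using t \<tau>_bound[OF U_D[OF z]] by (intro mult_mono) auto
  then obtain s where s: "\<bar>s\<bar> * norm (G z) \<le> d / 100" "F (z + s *\<^sub>R G z) = F z + t * \<tau> z"
    using F_line_solvable[OF z, of "t * \<tau> z"] by auto
  have v: "valid z s" using s(1) d by (simp add: valid_def)
  have "sol t z = s" unfolding sol_def
  proof (rule the_equality)
    show "valid z s \<and> F (z + s *\<^sub>R G z) = F z + t * \<tau> z" using v s by blast
    show "x = s" if "valid z x \<and> F (z + x *\<^sub>R G z) = F z + t * \<tau> z" for x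
      using that s(2) by (intro sol_unique[OF z v]) simp_all
  qed
  with s v show "\<bar>sol t z\<bar> * norm (G z) \<le> d / 100" "valid z (sol t z)"
    "F (z + sol t z *\<^sub>R G z) = F z + t * \<tau> z" by auto
qed

lemma sol_eq_0:
  assumes "z \<in> U" "t \<in> {0..1}" "t * \<tau> z = 0"
  shows "sol t z = 0"
proof (rule sol_unique[OF assms(1) _ sol(2)[OF assms(1,2)]])
  show "valid z 0" using d by (simp add: valid_def)
  show "F (z + 0 *\<^sub>R G z) = F (z + sol t z *\<^sub>R G z)" using sol(3)[OF assms(1,2)] assms(3) by simp
qed

lemma sol_bound: assumes "z \<in> U" "t \<in> {0..1}" shows "\<bar>sol t z\<bar> \<le> 1 / 50"
proof -
  have "\<bar>sol t z\<bar> * (d / 2) \<le> \<bar>sol t z\<bar> * norm (G z)" using U_G[OF assms(1)] by (rule mult_left_mono) simp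
  also have "\<dots> \<le> d / 100" by (rule sol(1)[OF assms])
  finally have "\<bar>sol t z\<bar> * d \<le> (1 / 50) * d" by (simp add: mult.commute)
  then show ?thesis using d by (rule mult_right_le_imp_le)
qed

text \<open>The growth of \<open>F\<close> along lines turns a residual into an error: the fixed
  value \<open>s = sol t z\<close>, inserted at a nearby point, leaves a residual that tends to 0,
  and \<open>8 / d\<^sup>2\<close> times it bounds the distance from \<open>s\<close> to the
  solution there.\<close>

lemma sol_continuous: "continuous_on ({0..1} \<times> U) (\<lambda>p. sol (fst p) (snd p))"
  unfolding continuous_on_def
proof
  fix p :: "real \<times> 'a" assume p: "p \<in> {0..1} \<times> U"
  obtain t z where tz: "p = (t, z)" "t \<in> {0..1}" "z \<in> U" using p by (cases p) auto
  define s where "s = sol t z"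
  let ?F = "at p within {0..1} \<times> U"
  have c: "continuous_on ({0..1} \<times> U) (\<lambda>q. f (snd q))" if "continuous_on D f" for f :: "'a \<Rightarrow> 'b::topological_space"
    by (rule continuous_on_compose2[OF that continuous_on_snd[OF continuous_on_id]]) (auto intro: U_D)
  have c\<tau>: "continuous_on D \<tau>"
    by (rule has_derivative_continuous_on[where f' = "\<lambda>z h. T z \<bullet> h"]) (rule \<tau>_deriv)
  have lim: "((\<lambda>q. f (snd q)) \<longlongrightarrow> f z) ?F" if "continuous_on D f" for f :: "'a \<Rightarrow> 'b::topological_space"
    using bspec[OF c[OF that, unfolded continuous_on_def] p] by (simp add: tz(1))
  have "((\<lambda>q. fst q) \<longlongrightarrow> fst p) ?F" "((\<lambda>q. snd q) \<longlongrightarrow> snd p) ?F"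
    by (intro tendsto_intros)+
  then have limt: "((\<lambda>q. fst q) \<longlongrightarrow> t) ?F" and limz: "((\<lambda>q. snd q) \<longlongrightarrow> z) ?F"
    by (simp_all add: tz(1))
  note limG = lim[OF G_cont] and limF = lim[OF F_cont] and lim\<tau> = lim[OF c\<tau>]
  have "((\<lambda>q. \<bar>s\<bar> * norm (G (snd q))) \<longlongrightarrow> \<bar>s\<bar> * norm (G z)) ?F"
    by (intro tendsto_intros limG)
  moreover have "\<bar>s\<bar> * norm (G z) < d / 4"
    using sol(1)[OF tz(3,2)] d by (simp add: s_def)
  ultimately have ev: "eventually (\<lambda>q. \<bar>s\<bar> * norm (G (snd q)) < d / 4) ?F"
    by (rule order_tendstoD)
  have y: "z + s *\<^sub>R G z \<in> ball a r" unfolding s_def by (intro valid_ball sol tz)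
  have "continuous_on (ball a r) F" by (rule continuous_on_subset[OF F_cont]) auto
  then have "isCont F (z + s *\<^sub>R G z)" using y by (simp add: continuous_on_eq_continuous_at)
  then have "((\<lambda>q. F (snd q + s *\<^sub>R G (snd q))) \<longlongrightarrow> F (z + s *\<^sub>R G z)) ?F"
    by (rule isCont_tendsto_compose) (intro tendsto_intros limG limz)
  then have "((\<lambda>q. 8 / d\<^sup>2 * \<bar>F (snd q) + fst q * \<tau> (snd q) - F (snd q + s *\<^sub>R G (snd q))\<bar>)
     \<longlongrightarrow> 8 / d\<^sup>2 * \<bar>F z + t * \<tau> z - F (z + s *\<^sub>R G z)\<bar>) ?F"
    by (intro tendsto_intros limF lim\<tau> limt)
  then have lim0: "((\<lambda>q. 8 / d\<^sup>2 * \<bar>F (snd q) + fst q * \<tau> (snd q) - F (snd q + s *\<^sub>R G (snd q))\<bar>) \<longlongrightarrow> 0) ?F"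
    using sol(3)[OF tz(3,2)] by (simp add: s_def)
  have evS: "eventually (\<lambda>q. q \<in> {0..1} \<times> U) ?F" by (simp add: eventually_at_filter)
  have "eventually (\<lambda>q. norm (sol (fst q) (snd q) - s)
      \<le> 8 / d\<^sup>2 * \<bar>F (snd q) + fst q * \<tau> (snd q) - F (snd q + s *\<^sub>R G (snd q))\<bar>) ?F"
    using ev evS
  proof eventually_elim
    case (elim q)
    then have *: "snd q \<in> U" "fst q \<in> {0..1}" "valid (snd q) s" by (auto simp: valid_def)
    have "\<bar>sol (fst q) (snd q) - s\<bar> * (d\<^sup>2 / 8)
      \<le> \<bar>F (snd q) + fst q * \<tau> (snd q) - F (snd q + s *\<^sub>R G (snd q))\<bar>"
      using F_line_expanding[OF *(1,3) sol(2)[OF *(1,2)]] sol(3)[OF *(1,2)] by simp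
    then show "norm (sol (fst q) (snd q) - s)
      \<le> 8 / d\<^sup>2 * \<bar>F (snd q) + fst q * \<tau> (snd q) - F (snd q + s *\<^sub>R G (snd q))\<bar>"
      using d by (simp add: field_simps)
  qed
  from Lim_null_comparison[OF this lim0]
  have "((\<lambda>q. sol (fst q) (snd q)) \<longlongrightarrow> s) ?F" by (simp add: LIM_zero_iff)
  then show "((\<lambda>q. sol (fst q) (snd q)) \<longlongrightarrow> sol (fst p) (snd p)) ?F"
    by (simp add: s_def tz(1))
qed

definition target :: "real \<Rightarrow> 'a \<Rightarrow> 'a" where "target t z = z + sol t z *\<^sub>R G z"

lemma target_ball: "z \<in> U \<Longrightarrow> t \<in> {0..1} \<Longrightarrow> target t z \<in> ball a r"
  unfolding target_def by (intro valid_ball sol)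

lemma target_G_pos: assumes "z \<in> U" "t \<in> {0..1}" shows "G (target t z) \<bullet> G z > 0"
proof -
  have "0 < d / 2" using d by simp
  also have "\<dots> \<le> norm (G z)" by (rule U_G[OF assms(1)])
  finally have "0 < (norm (G z))\<^sup>2 / 2" by simp
  also have "\<dots> \<le> G (target t z) \<bullet> G z"
    unfolding target_def by (rule valid_G(2)[OF assms(1) sol(2)[OF assms]])
  finally show ?thesis .
qed

text \<open>Implicit differentiation of
  \<open>F (z + s *\<^sub>R G z) - F z - t * \<tau> z = 0\<close>: minus the derivative in
  \<open>z\<close>, divided by the derivative in \<open>s\<close>.\<close>

definition dsol :: "real \<Rightarrow> 'a \<Rightarrow> 'a \<Rightarrow>\<^sub>L real" where
  "dsol t z = (1 / (G (target t z) \<bullet> G z)) *\<^sub>R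
     (blinfun_inner_left (G z + t *\<^sub>R T z - G (target t z)) -
      sol t z *\<^sub>R (blinfun_inner_left (G (target t z)) o\<^sub>L G' z))"

lemma sol_deriv:
  assumes z: "z \<in> U" and t: "t \<in> {0..1}"
  shows "(sol t has_derivative blinfun_apply (dsol t z)) (at z)"
proof -
  let ?y = "target t z" and ?s = "sol t z"
  let ?H = "\<lambda>p. F (fst p + snd p *\<^sub>R G (fst p)) - F (fst p) - t * \<tau> (fst p)"
  let ?H' = "\<lambda>p. G ?y \<bullet> (fst p + (?s *\<^sub>R G' z (fst p) + snd p *\<^sub>R G z)) - G z \<bullet> fst p - t * (T z \<bullet> fst p)"
  have zD: "z \<in> D" and zb: "z \<in> ball a r" using U_D[OF z] U_ball[OF z] by auto
  have dG: "(G has_derivative blinfun_apply (G' z)) (at z)"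
    and dF: "(F has_derivative (\<lambda>h. G z \<bullet> h)) (at z)"
    and d\<tau>: "(\<tau> has_derivative (\<lambda>h. T z \<bullet> h)) (at z)"
    using G_deriv[OF zD] F_deriv[OF zD] \<tau>_deriv[OF zD] at_ball[OF zb] by simp_all
  have yb: "?y \<in> ball a r" by (rule target_ball[OF z t])
  then have dFy: "(F has_derivative (\<lambda>h. G ?y \<bullet> h)) (at ?y)"
    using F_deriv[of ?y] at_ball[of ?y] by simp
  have fst: "((\<lambda>p. f (fst p)) has_derivative (\<lambda>p. f' (fst p))) (at (z, ?s))"
    if "(f has_derivative f') (at z)" for f :: "'a \<Rightarrow> 'b::real_normed_vector" and f'
  proof -
    have "(f has_derivative f') (at (fst (z, ?s)))" using that by simp
    from has_derivative_compose[OF has_derivative_fst[OF has_derivative_ident] this] show ?thesis .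
  qed
  have "((\<lambda>p. fst p + snd p *\<^sub>R G (fst p)) has_derivative
      (\<lambda>p. fst p + (?s *\<^sub>R G' z (fst p) + snd p *\<^sub>R G z))) (at (z, ?s))"
    using has_derivative_add[OF has_derivative_fst[OF has_derivative_ident]
        has_derivative_scaleR[OF has_derivative_snd[OF has_derivative_ident] fst[OF dG]]]
    by simp
  moreover have "(F has_derivative (\<lambda>h. G ?y \<bullet> h)) (at (fst (z, ?s) + snd (z, ?s) *\<^sub>R G (fst (z, ?s))))"
    using dFy by (simp add: target_def)
  ultimately have "((\<lambda>p. F (fst p + snd p *\<^sub>R G (fst p))) has_derivative
      (\<lambda>p. G ?y \<bullet> (fst p + (?s *\<^sub>R G' z (fst p) + snd p *\<^sub>R G z)))) (at (z, ?s))"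
    by (rule has_derivative_compose)
  then have "(?H has_derivative ?H') (at (z, ?s))"
    by (intro has_derivative_diff has_derivative_mult_right fst dF d\<tau>)
  then have H: "(?H has_derivative ?H') (at (z, ?s) within U \<times> UNIV)"
    by (rule has_derivative_at_withinI)
  have cont: "continuous (at z within U) (sol t)"
  proof -
    have "continuous_on U (\<lambda>z. (\<lambda>p. sol (fst p) (snd p)) (t, z))"
      by (rule continuous_on_compose2[OF sol_continuous]) (use t in \<open>auto intro!: continuous_intros\<close>)
    then show ?thesis using z by (simp add: continuous_on_eq_continuous_within)
  qed
  have H01: "?H' (0, 1) = G ?y \<bullet> G z" by (simp add: blinfun.zero_right)
  have "(sol t has_derivative (\<lambda>h. - ?H' (h, 0) / ?H' (0, 1))) (at z within U)"
  proof (rule implicit_function_has_derivative[OF H _ cont _ z])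
    show "?H' (0, 1) \<noteq> 0" unfolding H01 using target_G_pos[OF z t] by simp
    show "?H (x, sol t x) = 0" if "x \<in> U" for x using sol(3)[OF that t] by simp
  qed
  then have "(sol t has_derivative (\<lambda>h. - ?H' (h, 0) / ?H' (0, 1))) (at z)"
    using z open_U by (simp only: at_within_open)
  moreover have "- ?H' (h, 0) / ?H' (0, 1) = dsol t z h" for h
  proof -
    have "dsol t z h = (1 / (G ?y \<bullet> G z)) * ((G z + t *\<^sub>R T z - G ?y) \<bullet> h - ?s * (G ?y \<bullet> G' z h))"
      by (simp add: dsol_def blinfun.scaleR_left blinfun.diff_left inner_commute)
    moreover have "- ?H' (h, 0) = (G z + t *\<^sub>R T z - G ?y) \<bullet> h - ?s * (G ?y \<bullet> G' z h)"
      by (simp add: inner_add_left inner_add_right inner_diff_left)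
    ultimately show ?thesis unfolding H01 by simp
  qed
  ultimately show ?thesis by (simp only:)
qed

text \<open>Relative to \<open>m = norm (G z)\<close>, the numerator collects
  \<open>66 / 400\<close> from \<open>T\<close> (as \<open>d \<le> 2 * m\<close>),
  \<open>\<bar>sol t z\<bar>\<close> from the change of \<open>G\<close>, and \<open>3/2\<close>
  times \<open>\<bar>sol t z\<bar>\<close> from \<open>G'\<close>. With
  \<open>\<bar>sol t z\<bar> \<le> 1 / 50\<close> the sum is at most \<open>43 / 200\<close>; the
  denominator is at least \<open>m\<^sup>2 / 2\<close>.\<close>

lemma dsol_bound:
  assumes z: "z \<in> U" and t: "t \<in> {0..1}"
  shows "\<bar>dsol t z h\<bar> * norm (G z) \<le> 43 / 100 * norm h"
proof -
  let ?y = "target t z" and ?s = "\<bar>sol t z\<bar>"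
  define m where "m = norm (G z)"
  have dm: "d \<le> 2 * m" using U_G[OF z] by (simp add: m_def)
  then have m: "m > 0" using d by linarith
  note v = valid_G[OF z sol(2)[OF z t], folded target_def m_def]
  have T: "norm (t *\<^sub>R T z) \<le> 1 * (33 * d / 400)"
    unfolding norm_scaleR using t T_bound[OF U_D[OF z]] by (intro mult_mono) auto
  have "norm (G z + t *\<^sub>R T z - G ?y) \<le> norm (t *\<^sub>R T z) + norm (G ?y - G z)"
    using norm_triangle_ineq4[of "t *\<^sub>R T z" "G ?y - G z"] by (simp add: algebra_simps)
  also have "\<dots> \<le> 1 * (33 * d / 400) + ?s * m" by (intro add_mono T v)
  also have "\<dots> \<le> 66 / 400 * m + ?s * m" using dm by simp
  finally have 1: "norm (G z + t *\<^sub>R T z - G ?y) \<le> 66 / 400 * m + ?s * m" .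
  have "\<bar>(G z + t *\<^sub>R T z - G ?y) \<bullet> h\<bar> \<le> (66 / 400 * m + ?s * m) * norm h"
    by (rule order_trans[OF Cauchy_Schwarz_ineq2 mult_right_mono[OF 1 norm_ge_zero]])
  moreover have "\<bar>sol t z * (G ?y \<bullet> G' z h)\<bar> \<le> ?s * ((3/2 * m) * (1 * norm h))"
  proof -
    have "norm (G' z h) \<le> 1 * norm h"
      by (rule order_trans[OF norm_blinfun mult_right_mono[OF G'_bound[OF U_D[OF z]] norm_ge_zero]])
    then have "norm (G ?y) * norm (G' z h) \<le> (3/2 * m) * (1 * norm h)"
      using v(3) m by (intro mult_mono) auto
    then have "\<bar>G ?y \<bullet> G' z h\<bar> \<le> (3/2 * m) * (1 * norm h)"
      by (rule order_trans[OF Cauchy_Schwarz_ineq2])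
    then show ?thesis unfolding abs_mult by (rule mult_left_mono) simp
  qed
  ultimately have "\<bar>(G z + t *\<^sub>R T z - G ?y) \<bullet> h\<bar> + \<bar>sol t z * (G ?y \<bullet> G' z h)\<bar>
      \<le> (66 / 400 * m + ?s * m) * norm h + ?s * ((3/2 * m) * (1 * norm h))" by (rule add_mono)
  also have "\<dots> = (66 / 400 + 5 / 2 * ?s) * (m * norm h)" by (simp add: algebra_simps)
  also have "\<dots> \<le> (43 / 200) * (m * norm h)"
    using sol_bound[OF z t] m by (intro mult_right_mono) auto
  finally have "\<bar>(G z + t *\<^sub>R T z - G ?y) \<bullet> h - sol t z * (G ?y \<bullet> G' z h)\<bar> \<le> (43 / 200) * (m * norm h)"
    using abs_triangle_ineq4 order_trans by blast
  moreover have pos: "m\<^sup>2 / 2 > 0" using m by simp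
  ultimately have "\<bar>(G z + t *\<^sub>R T z - G ?y) \<bullet> h - sol t z * (G ?y \<bullet> G' z h)\<bar> / \<bar>G ?y \<bullet> G z\<bar>
      \<le> (43 / 200) * (m * norm h) / (m\<^sup>2 / 2)"
    using v(2) m by (intro frac_le) auto
  then have "\<bar>dsol t z h\<bar> * m \<le> (43 / 200) * (m * norm h) / (m\<^sup>2 / 2) * m"
    using m by (intro mult_right_mono)
      (simp_all add: dsol_def blinfun.scaleR_left blinfun.diff_left inner_commute)
  also have "\<dots> = 43 / 100 * norm h" using m by (simp add: field_simps power2_eq_square)
  finally show ?thesis by (simp add: m_def)
qed

section \<open>Gluing with the region at rest\<close>

definition disp :: "real \<Rightarrow> 'a \<Rightarrow> 'a" where
  "disp t z = (if z \<in> U then sol t z *\<^sub>R G z else 0)"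

definition ddisp :: "real \<Rightarrow> 'a \<Rightarrow> 'a \<Rightarrow>\<^sub>L 'a" where
  "ddisp t z = (if z \<in> U then sol t z *\<^sub>R G' z + (blinfun_scaleR_left (G z) o\<^sub>L dsol t z) else 0)"

lemma disp_V:
  assumes "z \<in> V" "t \<in> {0..1}"
  shows "disp t z = 0" "ddisp t z = 0"
proof -
  have "sol t z = 0" if "z \<in> U" using sol_eq_0[OF that assms(2)] \<tau>_V(1)[OF assms(1)] by simp
  moreover have "dsol t z = 0" if "sol t z = 0"
    using that \<tau>_V(2)[OF assms(1)] by (intro blinfun_eqI) (simp add: dsol_def target_def blinfun.scaleR_left)
  ultimately show "disp t z = 0" "ddisp t z = 0" by (auto simp: disp_def ddisp_def intro!: blinfun_eqI)
qed

lemma openin_U: "openin (top_of_set D) U"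
  using open_U U_D by (auto simp: openin_open)

lemma openin_V: "openin (top_of_set D) V"
proof -
  have "continuous_on D (\<lambda>z. \<bar>g z\<bar>)" by (intro continuous_intros g_cont)
  then have "openin (top_of_set D) (D \<inter> (\<lambda>z. \<bar>g z\<bar>) -` {d / 8<..})"
    by (rule continuous_openin_preimage_gen) simp
  also have "D \<inter> (\<lambda>z. \<bar>g z\<bar>) -` {d / 8<..} = V" by (auto simp: V_def)
  finally show ?thesis .
qed

lemma disp_deriv:
  assumes z: "z \<in> D" and t: "t \<in> {0..1}"
  shows "(disp t has_derivative blinfun_apply (ddisp t z)) (at z within D)"
proof (cases "z \<in> U")
  case True
  have zb: "z \<in> ball a r" by (rule U_ball[OF True])
  have "(G has_derivative blinfun_apply (G' z)) (at z)"
    using G_deriv[OF z] at_ball[OF zb] by simp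
  from has_derivative_scaleR[OF sol_deriv[OF True t] this]
  have "((\<lambda>x. sol t x *\<^sub>R G x) has_derivative blinfun_apply (ddisp t z)) (at z)"
    by (rule has_derivative_eq_rhs) (simp add: ddisp_def True fun_eq_iff blinfun.add_left blinfun.scaleR_left)
  then have "(disp t has_derivative blinfun_apply (ddisp t z)) (at z)"
    by (rule has_derivative_transform_within_open[OF _ open_U True]) (simp add: disp_def)
  then show ?thesis by (rule has_derivative_at_withinI)
next
  case False
  then have V: "z \<in> V" using z D_eq by blast
  obtain S where S: "open S" "V = D \<inter> S" using openin_V unfolding openin_open by blast
  have "(disp t has_derivative blinfun_apply (ddisp t z)) (at z within V)"
    by (rule has_derivative_transform[OF V, of _ "\<lambda>_. 0"])
      (simp_all add: disp_V[OF _ t] V blinfun.zero_left zero_blinfun.rep_eq)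
  moreover have "at z within V = at z within D"
    using S V by (intro at_within_nhd[of z S]) auto
  ultimately show ?thesis by simp
qed

text \<open>The two terms of the product rule contribute \<open>1 / 50\<close> and
  \<open>43 / 100\<close>, together less than the 1/2 allowed for a perturbation of the identity.
  The factor 400 in the closeness assumptions is there for this.\<close>

lemma ddisp_bound:
  assumes z: "z \<in> D" and t: "t \<in> {0..1}"
  shows "norm (ddisp t z) \<le> 1/2"
proof (cases "z \<in> U")
  case True
  show ?thesis
  proof (rule norm_blinfun_bound)
    fix h
    have "norm (sol t z *\<^sub>R G' z h) \<le> (1 / 50) * (1 * norm h)"
      unfolding norm_scaleR
      using sol_bound[OF True t] order_trans[OF norm_blinfun mult_right_mono[OF G'_bound[OF z] norm_ge_zero]]
      by (rule mult_mono) auto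
    moreover have "norm (dsol t z h *\<^sub>R G z) \<le> 43 / 100 * norm h"
      unfolding norm_scaleR by (rule dsol_bound[OF True t])
    ultimately have "norm (sol t z *\<^sub>R G' z h + dsol t z h *\<^sub>R G z) \<le> (1 / 50) * (1 * norm h) + 43 / 100 * norm h"
      by (rule norm_triangle_mono)
    also have "\<dots> \<le> 1/2 * norm h" by simp
    finally show "norm (ddisp t z h) \<le> 1/2 * norm h"
      by (simp add: ddisp_def True blinfun.add_left blinfun.scaleR_left)
  qed simp
qed (simp add: ddisp_def)

lemma continuous_on_pasted:
  assumes "continuous_on ({0..1} \<times> U) (\<lambda>(t, z). f t z)"
    and "\<And>t z. t \<in> {0..1} \<Longrightarrow> z \<in> V \<Longrightarrow> f t z = c"
  shows "continuous_on ({0..1::real} \<times> D) (\<lambda>(t, z). f t z)"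
proof -
  have eq: "{0..1::real} \<times> D = {0..1} \<times> U \<union> {0..1} \<times> V" using D_eq by blast
  have 1: "openin (top_of_set ({0..1::real} \<times> D)) ({0..1} \<times> U)"
    by (intro openin_Times openin_U openin_subtopology_self)
  have 2: "openin (top_of_set ({0..1::real} \<times> D)) ({0..1} \<times> V)"
    by (intro openin_Times openin_V openin_subtopology_self)
  have "continuous_on ({0..1} \<times> V) (\<lambda>_. c)" by (rule continuous_on_const)
  then have "continuous_on ({0..1} \<times> V) (\<lambda>(t, z). f t z)"
    by (rule continuous_on_eq) (auto simp: assms(2))
  from continuous_on_Un_local_open[OF 1[unfolded eq] 2[unfolded eq] assms(1) this]
  show ?thesis unfolding eq .
qed

lemma T_cont: "continuous_on D T"
proof -
  have "continuous_on D (\<lambda>z. cutoff (d / 8) (g z))" "continuous_on D (\<lambda>z. cutoff_deriv (d / 8) (g z))"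
    using d unfolding cutoff_def cutoff_deriv_def
    by (intro continuous_intros g_cont continuous_on_max; simp)+
  then show ?thesis unfolding T_def[abs_def]
    by (intro continuous_intros g_cont F_cont G_cont \<Gamma>_cont)
qed

lemma cont_snd: "continuous_on D f \<Longrightarrow> continuous_on ({0..1::real} \<times> U) (\<lambda>p. f (snd p))"
  by (rule continuous_on_compose2[OF _ continuous_on_snd[OF continuous_on_id]]) (auto intro: U_D)

lemma target_cont: "continuous_on ({0..1} \<times> U) (\<lambda>p. target (fst p) (snd p))"
  unfolding target_def by (intro continuous_intros sol_continuous cont_snd G_cont)

lemma G_target_cont: "continuous_on ({0..1} \<times> U) (\<lambda>p. G (target (fst p) (snd p)))"
proof (rule continuous_on_compose2[OF G_cont target_cont], rule image_subsetI)
  show "target (fst p) (snd p) \<in> D" if "p \<in> {0..1} \<times> U" for p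
    using target_ball[of "snd p" "fst p"] that by auto
qed

lemma dsol_cont: "continuous_on ({0..1} \<times> U) (\<lambda>p. dsol (fst p) (snd p))"
proof -
  have inner_left: "continuous_on S (\<lambda>p. blinfun_inner_left (f p))"
    if "continuous_on S f" for S and f :: "real \<times> 'a \<Rightarrow> 'a"
    by (rule bounded_linear.continuous_on[OF bounded_linear_blinfun_inner_left that])
  have pos: "G (target (fst p) (snd p)) \<bullet> G (snd p) \<noteq> 0" if "p \<in> {0..1} \<times> U" for p
    using target_G_pos[of "snd p" "fst p"] that by auto
  have comp: "continuous_on ({0..1} \<times> U) (\<lambda>p. blinfun_inner_left (G (target (fst p) (snd p))) o\<^sub>L G' (snd p))"
    by (intro bounded_bilinear.continuous_on[OF bounded_bilinear_blinfun_compose] inner_left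
        G_target_cont cont_snd G'_cont)
  have "continuous_on ({0..1} \<times> U) (\<lambda>p. 1 / (G (target (fst p) (snd p)) \<bullet> G (snd p)))"
    using pos by (intro continuous_on_divide continuous_on_const continuous_on_inner G_target_cont cont_snd G_cont) auto
  then show ?thesis unfolding dsol_def
    by (intro continuous_on_scaleR continuous_on_diff inner_left continuous_on_add comp
        G_target_cont cont_snd G_cont T_cont sol_continuous continuous_on_fst continuous_on_id)
qed

lemma disp_cont: "continuous_on ({0..1} \<times> D) (\<lambda>(t, z). disp t z)"
proof (rule continuous_on_pasted)
  have "continuous_on ({0..1} \<times> U) (\<lambda>p. sol (fst p) (snd p) *\<^sub>R G (snd p))"
    by (intro continuous_on_scaleR sol_continuous cont_snd G_cont)
  then show "continuous_on ({0..1} \<times> U) (\<lambda>(t, z). disp t z)"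
    by (rule continuous_on_eq) (auto simp: disp_def)
qed (rule disp_V)

lemma ddisp_cont: "continuous_on ({0..1} \<times> D) (\<lambda>(t, z). ddisp t z)"
proof (rule continuous_on_pasted)
  have "continuous_on ({0..1::real} \<times> U) (\<lambda>p. blinfun_scaleR_left (G (snd p)))"
    by (rule bounded_linear.continuous_on[OF bounded_linear_blinfun_scaleR_left cont_snd[OF G_cont]])
  from bounded_bilinear.continuous_on[OF bounded_bilinear_blinfun_compose this dsol_cont]
  have "continuous_on ({0..1} \<times> U) (\<lambda>p. sol (fst p) (snd p) *\<^sub>R G' (snd p)
      + (blinfun_scaleR_left (G (snd p)) o\<^sub>L dsol (fst p) (snd p)))"
    by (intro continuous_on_add[OF continuous_on_scaleR[OF sol_continuous cont_snd[OF G'_cont]]])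
  then show "continuous_on ({0..1} \<times> U) (\<lambda>(t, z). ddisp t z)"
    by (rule continuous_on_eq) (auto simp: ddisp_def)
qed (rule disp_V)

lemma diffeo: "t \<in> {0..1} \<Longrightarrow> C1_diffeo D (\<lambda>z. z + disp t z)"
proof (rule C1_diffeo_small_perturbation[where w' = "ddisp t"])
  assume t: "t \<in> {0..1}"
  have "continuous_on D (\<lambda>z. (\<lambda>(t, z). ddisp t z) (t, z))"
    by (rule continuous_on_compose2[OF ddisp_cont]) (use t in \<open>auto intro!: continuous_intros\<close>)
  then show "continuous_on D (ddisp t)" by simp
  fix z
  show "(disp t has_derivative blinfun_apply (ddisp t z)) (at z within D)" if "z \<in> D"
    by (rule disp_deriv[OF that t])
  show "norm (ddisp t z) \<le> 1/2" if "z \<in> D" by (rule ddisp_bound[OF that t])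
  show "disp t z = 0" if "z \<in> sphere a r"
    using that U_ball[of z] by (auto simp: disp_def)
qed

lemma F_diffeo: assumes "z \<in> D" shows "F (z + disp 1 z) = F z + \<tau> z"
proof (cases "z \<in> U")
  case True
  then show ?thesis using sol(3)[of z 1] by (simp add: disp_def)
next
  case False
  then have "z \<in> V" using assms D_eq by blast
  then show ?thesis using disp_V(1)[of z 1] \<tau>_V(1) by simp
qed

text \<open>At a zero of \<open>F + \<tau>\<close> the value \<open>g z\<close> is the fraction
  \<open>1 - cutoff (d / 8) (g z)\<close> of \<open>g z - F z\<close>, and this fraction is at most
  linear in \<open>\<bar>g z\<bar>\<close>. The resulting inequality
  \<open>\<bar>g z\<bar> \<le> \<bar>g z\<bar> / 25\<close> leaves only 0.\<close>

lemma zero_iff: assumes "z \<in> D" shows "F z + \<tau> z = 0 \<longleftrightarrow> g z = 0"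
proof
  assume "g z = 0"
  then show "F z + \<tau> z = 0" by (simp add: \<tau>_def cutoff_def)
next
  assume "F z + \<tau> z = 0"
  then have "g z = (1 - cutoff (d / 8) (g z)) * (g z - F z)" by (simp add: \<tau>_def algebra_simps)
  then have "\<bar>g z\<bar> = (1 - cutoff (d / 8) (g z)) * \<bar>g z - F z\<bar>"
    using cutoff_bounds[of "d / 8" "g z"] by (metis abs_mult abs_of_nonneg diff_ge_0_iff_ge)
  also have "\<dots> \<le> (2 * \<bar>g z\<bar> / (d / 8)) * (d\<^sup>2 / 400)"
    using cutoff_near_0[of "d / 8" "g z"] close(1)[OF assms] d by (intro mult_mono) auto
  also have "\<dots> = \<bar>g z\<bar> * (d / 25)" using d by (simp add: power2_eq_square)
  also have "\<dots> \<le> \<bar>g z\<bar> * (1 / 25)" using d_le_1 by (intro mult_left_mono) auto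
  finally show "g z = 0" by simp
qed

text \<open>\<open>F\<close> composed with the final map is \<open>F + \<tau>\<close>, so that map
  sends the zeros of \<open>g\<close> to the zeros of \<open>F\<close>, not the other way round. At
  time 0 no change of \<open>F\<close> is prescribed and nothing moves.\<close>

lemma rigidly_isotopic: "(zero_set D g, zero_set D F) \<in> rigid_isotopy D"
proof -
  have bij: "bij_betw (\<lambda>z. z + disp 1 z) D D" using diffeo[of 1] by (simp add: C1_diffeo_def)
  have "(\<lambda>z. z + disp 1 z) ` zero_set D g = zero_set D F"
  proof -
    have im: "(\<lambda>z. z + disp 1 z) ` D = D" using bij by (simp add: bij_betw_def)
    have "z + disp 1 z \<in> zero_set D F" if "z \<in> zero_set D g" for z
      using that im F_diffeo[of z] zero_iff[of z] by (auto simp: zero_set_def)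
    moreover have "\<exists>z\<in>zero_set D g. y = z + disp 1 z" if "y \<in> zero_set D F" for y
    proof -
      have "y \<in> (\<lambda>z. z + disp 1 z) ` D" using that im by (simp add: zero_set_def)
      then obtain z where "z \<in> D" "y = z + disp 1 z" by blast
      then show ?thesis using that F_diffeo[of z] zero_iff[of z] by (auto simp: zero_set_def)
    qed
    ultimately show ?thesis by blast
  qed
  moreover have "continuous_diffeo_family D (\<lambda>t z. z + disp t z)"
    unfolding continuous_diffeo_family_def
  proof (intro conjI ballI exI[of _ "\<lambda>t z. id_blinfun + ddisp t z"])
    have "continuous_on ({0..1::real} \<times> D) (\<lambda>p. snd p + (\<lambda>(t, z). disp t z) p)"
      by (intro continuous_intros disp_cont)
    then show "continuous_on ({0..1} \<times> D) (\<lambda>(t, z). z + disp t z)" by (simp add: case_prod_beta')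
    have "continuous_on ({0..1::real} \<times> D) (\<lambda>p. id_blinfun + (\<lambda>(t, z). ddisp t z) p)"
      by (intro continuous_intros ddisp_cont)
    then show "continuous_on ({0..1} \<times> D) (\<lambda>(t, z). id_blinfun + ddisp t z)" by (simp add: case_prod_beta')
    fix t :: real assume t: "t \<in> {0..1}"
    show "C1_diffeo D (\<lambda>z. z + disp t z)" by (rule diffeo[OF t])
    fix z assume z: "z \<in> D"
    show "((\<lambda>z. z + disp t z) has_derivative blinfun_apply (id_blinfun + ddisp t z)) (at z within D)"
      using has_derivative_add[OF has_derivative_ident disp_deriv[OF z t]]
      by (rule has_derivative_eq_rhs) (simp add: fun_eq_iff blinfun.add_left)
  qed
  moreover have "disp 0 z = 0" for z
    using sol_eq_0[of z 0] by (simp add: disp_def)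
  ultimately show ?thesis
    unfolding rigid_isotopy_def
    by (auto simp: zero_set_def intro!: exI[of _ "\<lambda>t z. z + disp t z"])
qed

end

section \<open>Derivatives on a ball\<close>

text \<open>At a boundary point only the directions \<open>y - z\<close> with \<open>y\<close> in
  the ball are seen, through one-sided derivatives along segments. They suffice: a multiple
  \<open>e *\<^sub>R h\<close> of any \<open>h\<close> is the difference of the directions towards
  \<open>a + e *\<^sub>R h\<close> and towards \<open>a\<close>.\<close>

lemma has_derivative_unique_within_cball:
  fixes f :: "'a::euclidean_space \<Rightarrow> 'b::real_normed_vector"
  assumes r: "r > 0" and z: "z \<in> cball a r"
    and A: "(f has_derivative A) (at z within cball a r)"
    and B: "(f has_derivative B) (at z within cball a r)"
  shows "A = B"
proof -
  interpret A: bounded_linear A using A by (rule has_derivative_bounded_linear)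
  interpret B: bounded_linear B using B by (rule has_derivative_bounded_linear)
  have dir: "A (y - z) = B (y - z)" if y: "y \<in> cball a r" for y
  proof -
    let ?c = "\<lambda>t. z + t *\<^sub>R (y - z)"
    have c: "?c ` {0..1} \<subseteq> cball a r"
    proof (rule image_subsetI)
      fix t :: real assume "t \<in> {0..1}"
      then have "(1 - t) *\<^sub>R z + t *\<^sub>R y \<in> cball a r"
        using z y convex_cball[of a r] by (intro convexD) auto
      then show "?c t \<in> cball a r" by (simp add: algebra_simps)
    qed
    have dc: "(?c has_derivative (\<lambda>t. t *\<^sub>R (y - z))) (at 0 within {0..1})"
      by (auto intro!: derivative_eq_intros)
    have lin: "((\<lambda>t. f (?c t)) has_vector_derivative L (y - z)) (at 0 within {0..1})"
      if L: "(f has_derivative L) (at z within cball a r)" and "bounded_linear L" for L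
    proof -
      interpret bounded_linear L by fact
      have "(f has_derivative L) (at (?c 0) within ?c ` {0..1})"
        using has_derivative_subset[OF L c] by simp
      from diff_chain_within[OF dc this] show ?thesis
        unfolding has_vector_derivative_def o_def by (simp only: scaleR)
    qed
    show ?thesis
      using vector_derivative_unique_within_closed_interval[of 0 1 0, unfolded box_real, OF _ _
          lin[OF A A.bounded_linear_axioms] lin[OF B B.bounded_linear_axioms]]
      by simp
  qed
  show ?thesis
  proof
    fix h :: 'a
    define e where "e = r / (norm h + 1)"
    have e: "e > 0" using r by (simp add: e_def add_nonneg_pos)
    have "e * norm h \<le> e * (norm h + 1)" using e by simp
    also have "\<dots> = r"
    proof -
      have "norm h + 1 \<noteq> 0" using norm_ge_zero[of h] by linarith
      then show ?thesis by (simp only: e_def times_divide_eq_left nonzero_mult_div_cancel_right not_False_eq_True)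
    qed
    finally have "e * norm h \<le> r" .
    then have "a + e *\<^sub>R h \<in> cball a r" using e by (simp add: dist_norm)
    moreover have "a \<in> cball a r" using r by simp
    ultimately have "A ((a + e *\<^sub>R h) - z) - A (a - z) = B ((a + e *\<^sub>R h) - z) - B (a - z)"
      by (simp only: dir)
    then have "e *\<^sub>R A h = e *\<^sub>R B h"
      unfolding A.diff[symmetric] B.diff[symmetric] by (simp add: A.scaleR B.scaleR)
    then show "A h = B h" using e by simp
  qed
qed

text \<open>The second difference is symmetric in \<open>h\<close> and \<open>k\<close>, so its approximation by \<open>s\<^sup>2 * (L k \<bullet> h)\<close> yields
  the symmetry of \<open>L\<close> from differentiability of \<open>G\<close> at the single point \<open>z\<close>.\<close>

lemma second_difference_approx:
  fixes f :: "'a::real_inner \<Rightarrow> real"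
  assumes f: "\<And>x. norm (x - z) < d \<Longrightarrow> (f has_derivative (\<lambda>h. G x \<bullet> h)) (at x)"
    and G: "\<And>x. norm (x - z) < d \<Longrightarrow> norm (G x - G z - L (x - z)) \<le> e * norm (x - z)"
    and L: "bounded_linear L" and e: "e > 0" and s: "s > 0" "s * (norm h + norm k) < d"
  shows "\<bar>f (z + s *\<^sub>R h + s *\<^sub>R k) - f (z + s *\<^sub>R h) - f (z + s *\<^sub>R k) + f z - s\<^sup>2 * (L k \<bullet> h)\<bar>
    \<le> 2 * e * s\<^sup>2 * (norm h + norm k)\<^sup>2"
proof -
  interpret L: bounded_linear L by fact
  define \<phi> where "\<phi> x = f (z + x *\<^sub>R h + s *\<^sub>R k) - f (z + x *\<^sub>R h)" for x
  have near: "norm (x *\<^sub>R h) \<le> s * (norm h + norm k)" "norm (x *\<^sub>R h + s *\<^sub>R k) \<le> s * (norm h + norm k)"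
    if "0 \<le> x" "x \<le> s" for x
  proof -
    have 1: "x * norm h \<le> s * norm h" using that by (intro mult_right_mono) auto
    have 2: "0 \<le> s * norm k" using s by simp
    have 3: "norm (x *\<^sub>R h) = x * norm h" "norm (s *\<^sub>R k) = s * norm k" using that s by simp_all
    show "norm (x *\<^sub>R h) \<le> s * (norm h + norm k)" unfolding distrib_left 3 using 1 2 by linarith
    show "norm (x *\<^sub>R h + s *\<^sub>R k) \<le> s * (norm h + norm k)"
      using norm_triangle_ineq[of "x *\<^sub>R h" "s *\<^sub>R k"] 1 unfolding distrib_left 3 by linarith
  qed
  have d: "((\<lambda>x. f (z + x *\<^sub>R h + v)) has_real_derivative G (z + x *\<^sub>R h + v) \<bullet> h) (at x)"
    if "norm (x *\<^sub>R h + v) < d" for x v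
  proof -
    have "((\<lambda>x. z + x *\<^sub>R h + v) has_derivative (\<lambda>y. y *\<^sub>R h)) (at x)"
      by (auto intro!: derivative_eq_intros)
    from has_derivative_compose[OF this f[of "z + x *\<^sub>R h + v"]] that
    have "((\<lambda>x. f (z + x *\<^sub>R h + v)) has_derivative (\<lambda>y. G (z + x *\<^sub>R h + v) \<bullet> (y *\<^sub>R h))) (at x)"
      by (simp add: algebra_simps)
    then show ?thesis unfolding has_field_derivative_def
      by (rule has_derivative_eq_rhs) (simp add: fun_eq_iff)
  qed
  have "DERIV \<phi> x :> (G (z + x *\<^sub>R h + s *\<^sub>R k) - G (z + x *\<^sub>R h)) \<bullet> h" if "0 \<le> x" "x \<le> s" for x
  proof -
    have "norm (x *\<^sub>R h + s *\<^sub>R k) < d" "norm (x *\<^sub>R h + 0) < d" using near[OF that] s(2) by auto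
    from DERIV_diff[OF d[OF this(1)] d[OF this(2)]] show ?thesis
      by (simp add: \<phi>_def[abs_def] inner_diff_left)
  qed
  from MVT2[OF s(1) this] obtain x where x: "0 < x" "x < s"
    "\<phi> s - \<phi> 0 = (s - 0) * ((G (z + x *\<^sub>R h + s *\<^sub>R k) - G (z + x *\<^sub>R h)) \<bullet> h)" by blast
  define N where "N = norm h + norm k"
  have G': "norm (G (z + v) - G z - L v) \<le> e * (s * N)" if "norm v \<le> s * N" for v
  proof -
    have "norm v < d" using that s(2) by (simp add: N_def)
    then have "norm (G (z + v) - G z - L v) \<le> e * norm v" using G[of "z + v"] by simp
    also have "\<dots> \<le> e * (s * N)" using that e by (intro mult_left_mono) auto
    finally show ?thesis .
  qed
  define R where "R = (G (z + (x *\<^sub>R h + s *\<^sub>R k)) - G z - L (x *\<^sub>R h + s *\<^sub>R k)) - (G (z + x *\<^sub>R h) - G z - L (x *\<^sub>R h))"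
  have R: "norm R \<le> e * (s * N) + e * (s * N)"
    unfolding R_def using near[of x] x
    by (intro order_trans[OF norm_triangle_ineq4] add_mono G') (auto simp: N_def)
  have Req: "G (z + x *\<^sub>R h + s *\<^sub>R k) - G (z + x *\<^sub>R h) = s *\<^sub>R L k + R"
    by (simp add: R_def L.add L.scaleR add.assoc)
  have "f (z + s *\<^sub>R h + s *\<^sub>R k) - f (z + s *\<^sub>R h) - f (z + s *\<^sub>R k) + f z = \<phi> s - \<phi> 0"
    by (simp add: \<phi>_def)
  also have "\<dots> = s * ((s *\<^sub>R L k + R) \<bullet> h)" unfolding x(3) Req by simp
  also have "\<dots> = s\<^sup>2 * (L k \<bullet> h) + s * (R \<bullet> h)"
    by (simp add: inner_add_left algebra_simps power2_eq_square)
  finally have "\<bar>f (z + s *\<^sub>R h + s *\<^sub>R k) - f (z + s *\<^sub>R h) - f (z + s *\<^sub>R k) + f z - s\<^sup>2 * (L k \<bullet> h)\<bar> = s * \<bar>R \<bullet> h\<bar>"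
    using s by (simp add: abs_mult)
  also have "\<dots> \<le> s * ((e * (s * N) + e * (s * N)) * N)"
  proof (rule mult_left_mono)
    have "norm R * norm h \<le> (e * (s * N) + e * (s * N)) * N"
      using R e s by (intro mult_mono) (auto simp: N_def)
    then show "\<bar>R \<bullet> h\<bar> \<le> (e * (s * N) + e * (s * N)) * N"
      by (rule order_trans[OF Cauchy_Schwarz_ineq2])
  qed (use s in simp)
  also have "\<dots> = 2 * e * s\<^sup>2 * (norm h + norm k)\<^sup>2"
    by (simp add: N_def[symmetric] power2_eq_square algebra_simps)
  finally show ?thesis .
qed

lemma second_derivative_symmetric:
  fixes f :: "'a::real_inner \<Rightarrow> real"
  assumes S: "open S" "z \<in> S" and f: "\<And>x. x \<in> S \<Longrightarrow> (f has_derivative (\<lambda>h. G x \<bullet> h)) (at x)"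
    and G: "(G has_derivative L) (at z)"
  shows "L h \<bullet> k = L k \<bullet> h"
proof (rule ccontr)
  assume ne: "L h \<bullet> k \<noteq> L k \<bullet> h"
  define N where "N = norm h + norm k"
  have L: "bounded_linear L" using G by (rule has_derivative_bounded_linear)
  define c where "c = \<bar>L h \<bullet> k - L k \<bullet> h\<bar>"
  have c: "c > 0" using ne by (simp add: c_def)
  define K where "K = N\<^sup>2 + 1"
  have K: "K > 0" "N\<^sup>2 \<le> K" by (simp_all add: K_def add_nonneg_pos)
  \<comment> \<open>The two estimates add up to \<open>4 * e * N\<^sup>2\<close> after division by
    \<open>s\<^sup>2\<close>; the 8 makes this at most half of the asymmetry \<open>c\<close>.
    \<open>K\<close> stays positive even if both vectors vanish.\<close>
  define e where "e = c / (8 * K)"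
  have e: "e > 0" using c K by (simp add: e_def)
  obtain d1 where d1: "d1 > 0" "ball z d1 \<subseteq> S" using S by (rule openE)
  obtain d2 where d2: "d2 > 0" "\<And>x. norm (x - z) < d2 \<Longrightarrow> norm (G x - G z - L (x - z)) \<le> e * norm (x - z)"
    using G e unfolding has_derivative_at_alt by blast
  define d where "d = min d1 d2"
  have d: "d > 0" using d1 d2 by (simp add: d_def)
  have fd: "(f has_derivative (\<lambda>h. G x \<bullet> h)) (at x)" if "norm (x - z) < d" for x
    using that d1(2) by (intro f) (auto simp: d_def dist_norm norm_minus_commute)
  have Gd: "norm (G x - G z - L (x - z)) \<le> e * norm (x - z)" if "norm (x - z) < d" for x
    using that by (intro d2) (simp add: d_def)
  define s where "s = d / (2 * (N + 1))"
  have N: "N \<ge> 0" by (simp add: N_def)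
  have s: "s > 0" using d N by (simp add: s_def)
  have "2 * (N + 1) \<noteq> 0" using N by simp
  then have "s * (2 * (N + 1)) = d" by (simp only: s_def times_divide_eq_left nonzero_mult_div_cancel_right not_False_eq_True)
  then have "2 * (s * N) + 2 * s = d" by (simp add: algebra_simps)
  moreover have "s * N \<ge> 0" using s N by simp
  ultimately have "s * N < d" using s by linarith
  then have sd: "s * (norm h + norm k) < d" "s * (norm k + norm h) < d" by (simp_all add: N_def add.commute)
  let ?Q = "f (z + s *\<^sub>R h + s *\<^sub>R k) - f (z + s *\<^sub>R h) - f (z + s *\<^sub>R k) + f z"
  have 1: "\<bar>?Q - s\<^sup>2 * (L k \<bullet> h)\<bar> \<le> 2 * e * s\<^sup>2 * N\<^sup>2"
    unfolding N_def by (rule second_difference_approx[OF fd Gd L e s sd(1)])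
  have 2: "\<bar>?Q - s\<^sup>2 * (L h \<bullet> k)\<bar> \<le> 2 * e * s\<^sup>2 * N\<^sup>2"
    using second_difference_approx[OF fd Gd L e s sd(2)] by (simp add: N_def algebra_simps)
  have "s\<^sup>2 * c = \<bar>s\<^sup>2 * (L h \<bullet> k) - s\<^sup>2 * (L k \<bullet> h)\<bar>"
    by (simp add: c_def abs_mult right_diff_distrib[symmetric])
  also have "\<dots> \<le> 2 * e * s\<^sup>2 * N\<^sup>2 + 2 * e * s\<^sup>2 * N\<^sup>2" using 1 2 by linarith
  also have "\<dots> = s\<^sup>2 * (4 * e * N\<^sup>2)" by simp
  finally have "c \<le> 4 * e * N\<^sup>2" using s by simp
  also have "\<dots> \<le> 4 * e * K" using e K by simp
  also have "\<dots> = c / 2" using K by (simp add: e_def)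
  finally show False using c by simp
qed

text \<open>Boundary points have no full neighbourhood in the disk; there the identity is the limit
  of its interior instances, by continuity of \<open>G'\<close>.\<close>

lemma second_derivative_symmetric_cball:
  fixes f :: "'a::euclidean_space \<Rightarrow> real"
  assumes r: "r > 0" and z: "z \<in> cball a r"
    and f: "\<And>z. z \<in> cball a r \<Longrightarrow> (f has_derivative (\<lambda>h. G z \<bullet> h)) (at z within cball a r)"
    and G: "\<And>z. z \<in> cball a r \<Longrightarrow> (G has_derivative blinfun_apply (G' z)) (at z within cball a r)"
    and G': "continuous_on (cball a r) G'"
  shows "G' z h \<bullet> k = G' z k \<bullet> h"
proof -
  have at: "at z within cball a r = at z" if "z \<in> ball a r" for z
    using that by (intro at_within_interior) simp
  have 0: "G' z h \<bullet> k - G' z k \<bullet> h = 0" if "z \<in> ball a r" for z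
  proof -
    have "(f has_derivative (\<lambda>h. G x \<bullet> h)) (at x)" if "x \<in> ball a r" for x
      using f[of x] at[OF that] that by simp
    moreover have "(G has_derivative blinfun_apply (G' z)) (at z)"
      using G[of z] at[OF that] that by simp
    ultimately show ?thesis
      using second_derivative_symmetric[of "ball a r" z f G "blinfun_apply (G' z)" h k] that by simp
  qed
  have cl: "closure (ball a r) = cball a r" using r by simp
  have "continuous_on (cball a r) (\<lambda>z. G' z h \<bullet> k - G' z k \<bullet> h)"
    by (intro continuous_intros G')
  from continuous_constant_on_closure[of "ball a r" _ 0, unfolded cl, OF this 0 z]
  show ?thesis by simp
qed

text \<open>\<open>J\<close> is the Riesz isomorphism from functionals to vectors, written in the
  basis. Being bounded and linear, it carries the derivative of \<open>f'\<close> to the derivative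
  of the gradient field.\<close>

lemma C2_on_obtain:
  fixes f :: "'a::euclidean_space \<Rightarrow> real"
  assumes "C2_on D f"
  obtains G G' where "\<And>z. z \<in> D \<Longrightarrow> (f has_derivative (\<lambda>h. G z \<bullet> h)) (at z within D)"
    "\<And>z. z \<in> D \<Longrightarrow> (G has_derivative blinfun_apply (G' z)) (at z within D)"
    "continuous_on D (G' :: 'a \<Rightarrow> 'a \<Rightarrow>\<^sub>L 'a)"
proof -
  from assms obtain f' where f': "\<And>z. z \<in> D \<Longrightarrow> (f has_derivative blinfun_apply (f' z)) (at z within D)"
    and "C1_on D f'" by (auto simp: C2_on_def)
  then obtain f'' where f'': "\<And>z. z \<in> D \<Longrightarrow> (f' has_derivative blinfun_apply (f'' z)) (at z within D)"
    "continuous_on D f''" by (auto simp: C1_on_def)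
  define J :: "('a \<Rightarrow>\<^sub>L real) \<Rightarrow> 'a" where "J A = (\<Sum>b\<in>Basis. blinfun_apply A b *\<^sub>R b)" for A
  have J: "bounded_linear J" unfolding J_def
    by (intro bounded_linear_sum bounded_linear_compose[OF bounded_linear_scaleR_left] blinfun.bounded_linear_left)
  have JA: "J A \<bullet> h = A h" for A h
  proof -
    have "A h = A (\<Sum>b\<in>Basis. (h \<bullet> b) *\<^sub>R b)" by (simp add: euclidean_representation)
    also have "\<dots> = (\<Sum>b\<in>Basis. (h \<bullet> b) * A b)" by (simp add: blinfun.sum_right blinfun.scaleR_right)
    also have "\<dots> = J A \<bullet> h" by (simp add: J_def inner_sum_left inner_commute[of h] mult.commute)
    finally show ?thesis ..
  qed
  have Jb: "blinfun_apply (Blinfun J) = J" using J by (rule bounded_linear_Blinfun_apply)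
  show ?thesis
  proof (rule that[of "\<lambda>z. J (f' z)" "\<lambda>z. Blinfun J o\<^sub>L f'' z"])
    fix z assume z: "z \<in> D"
    show "(f has_derivative (\<lambda>h. J (f' z) \<bullet> h)) (at z within D)"
      using f'[OF z] by (simp add: JA)
    show "((\<lambda>z. J (f' z)) has_derivative blinfun_apply (Blinfun J o\<^sub>L f'' z)) (at z within D)"
      using bounded_linear.has_derivative[OF J f''(1)[OF z]]
      by (rule has_derivative_eq_rhs) (simp add: fun_eq_iff Jb)
  next
    show "continuous_on D (\<lambda>z. Blinfun J o\<^sub>L f'' z)"
      by (intro bounded_bilinear.continuous_on[OF bounded_bilinear_blinfun_compose] continuous_on_const f''(2))
  qed
qed

section \<open>The condition number\<close>

lemma partial_deriv_eq:
  assumes "r > 0" "z \<in> cball a r" "(f has_derivative f') (at z within cball a r)"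
  shows "partial_deriv (cball a r) i f z = f' (axis i 1)"
proof -
  have "f differentiable (at z within cball a r)" using assms(3) unfolding differentiable_def by blast
  then have "(f has_derivative frechet_derivative f (at z within cball a r)) (at z within cball a r)"
    by (simp only: frechet_derivative_works)
  from has_derivative_unique_within_cball[OF assms(1,2) this assms(3)]
  show ?thesis by (simp add: partial_deriv_def)
qed

section \<open>Multi-indices as lists of coordinates\<close>

lemma count_list_eq_imp_mset_eq:
  assumes "count_list js = count_list ks" shows "mset js = mset ks"
proof (rule multiset_eqI)
  show "count (mset js) x = count (mset ks) x" for x
    using fun_cong[OF assms, of x] by (simp add: count_mset)
qed

lemma ex_count_list_eq:
  fixes \<alpha> :: "'n::finite \<Rightarrow> nat"
  obtains js where "count_list js = \<alpha>"
proof -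
  have "count (Abs_multiset \<alpha>) = \<alpha>" by (intro Abs_multiset_inverse) simp
  moreover obtain js where "mset js = Abs_multiset \<alpha>" using ex_mset by blast
  ultimately have "count_list js = \<alpha>" by (simp add: fun_eq_iff count_mset[symmetric])
  then show ?thesis by (rule that)
qed

text \<open>Passing to lists gives finiteness of the index set of the sum in \<open>C2_norm\<close>
  and reduces multi-indices of order at most 2 to the three list shapes of
  \<open>partial2\<close>.\<close>

lemma multi_indices_eq:
  "{\<alpha> :: 'n::finite \<Rightarrow> nat. (\<Sum>i\<in>UNIV. \<alpha> i) \<le> k} = count_list ` {js. length js \<le> k}"
proof -
  have len: "(\<Sum>i\<in>UNIV. count_list js i) = length js" for js :: "'n list"
    by (rule sum_count_set) auto
  show ?thesis
  proof (intro equalityI subsetI)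
    fix \<alpha> :: "'n \<Rightarrow> nat" assume "\<alpha> \<in> {\<alpha>. (\<Sum>i\<in>UNIV. \<alpha> i) \<le> k}"
    moreover obtain js where "count_list js = \<alpha>" by (rule ex_count_list_eq)
    ultimately show "\<alpha> \<in> count_list ` {js. length js \<le> k}" using len[of js] by auto
  next
    fix \<alpha> :: "'n \<Rightarrow> nat" assume "\<alpha> \<in> count_list ` {js. length js \<le> k}"
    then show "\<alpha> \<in> {\<alpha>. (\<Sum>i\<in>UNIV. \<alpha> i) \<le> k}" using len by auto
  qed
qed

lemma finite_multi_indices: "finite {\<alpha> :: 'n::finite \<Rightarrow> nat. (\<Sum>i\<in>UNIV. \<alpha> i) \<le> k}"
proof -
  have "finite {js :: 'n list. length js \<le> k}"
    using finite_lists_length_le[of "UNIV :: 'n set" k] by simp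
  then show ?thesis unfolding multi_indices_eq by (rule finite_imageI)
qed

locale C2_function =
  fixes a :: "real^'n" and r :: real and f :: "real^'n \<Rightarrow> real"
    and G :: "real^'n \<Rightarrow> real^'n" and G' :: "real^'n \<Rightarrow> (real^'n) \<Rightarrow>\<^sub>L (real^'n)"
  assumes r: "r > 0"
    and f_deriv: "\<And>z. z \<in> cball a r \<Longrightarrow> (f has_derivative (\<lambda>h. G z \<bullet> h)) (at z within cball a r)"
    and G_deriv: "\<And>z. z \<in> cball a r \<Longrightarrow> (G has_derivative blinfun_apply (G' z)) (at z within cball a r)"
    and G'_cont: "continuous_on (cball a r) G'"
begin

abbreviation "D \<equiv> cball a r"

lemma f_cont: "continuous_on D f"
  by (rule has_derivative_continuous_on[where f' = "\<lambda>z h. G z \<bullet> h"]) (rule f_deriv)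

lemma G_cont: "continuous_on D G"
  by (rule has_derivative_continuous_on[where f' = "\<lambda>z. blinfun_apply (G' z)"]) (rule G_deriv)

lemma partial_deriv_f: "z \<in> D \<Longrightarrow> partial_deriv D i f z = G z $ i"
  using partial_deriv_eq[OF r _ f_deriv, of z] by (simp add: inner_axis)

lemma gradient_f: "z \<in> D \<Longrightarrow> gradient D f z = G z"
  by (simp add: gradient_def partial_deriv_f vec_eq_iff)

lemma partial_deriv2_f:
  assumes z: "z \<in> D" shows "partial_deriv D i (partial_deriv D j f) z = G' z (axis i 1) $ j"
proof -
  have "((\<lambda>z. G z $ j) has_derivative (\<lambda>h. G' z h $ j)) (at z within D)"
    by (rule bounded_linear.has_derivative[OF bounded_linear_vec_nth G_deriv[OF z]])
  from has_derivative_transform[OF z partial_deriv_f this]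
  have "(partial_deriv D j f has_derivative (\<lambda>h. G' z h $ j)) (at z within D)" .
  from partial_deriv_eq[OF r z this] show ?thesis .
qed

lemma G'_symmetric: "z \<in> D \<Longrightarrow> G' z (axis i 1) $ j = G' z (axis j 1) $ i"
  using second_derivative_symmetric_cball[OF r _ f_deriv G_deriv G'_cont, of z "axis i 1" "axis j 1"]
  by (simp add: inner_axis)

definition partial2 :: "'n list \<Rightarrow> real^'n \<Rightarrow> real" where
  "partial2 js z = (case js of [] \<Rightarrow> f z | [i] \<Rightarrow> G z $ i | i # j # _ \<Rightarrow> G' z (axis i 1) $ j)"

text \<open>\<open>multi_partial\<close> picks some list with the right counts. In order 2 it may be
  \<open>[i, j]\<close> or \<open>[j, i]\<close>, and symmetry of \<open>G'\<close> makes the value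
  independent of the pick.\<close>

lemma multi_partial_f:
  assumes z: "z \<in> D" and len: "length js \<le> 2"
  shows "multi_partial D (count_list js) f z = partial2 js z"
proof -
  define ks where "ks = (SOME ks. \<forall>i. count_list ks i = count_list js i)"
  have "\<forall>i. count_list ks i = count_list js i"
    unfolding ks_def by (rule someI[of _ js]) simp
  then have m: "mset ks = mset js" by (intro count_list_eq_imp_mset_eq) auto
  have eq: "multi_partial D (count_list js) f z = foldr (partial_deriv D) ks f z"
    by (simp add: multi_partial_def ks_def)
  have "length js = 0 \<or> length js = 1 \<or> length js = 2" using len by presburger
  then consider "js = []" | i where "js = [i]" | i j where "js = [i, j]"
    by (auto simp: length_Suc_conv numeral_2_eq_2)
  then show ?thesis
  proof cases
    case 1
    then show ?thesis using m eq by (simp add: partial2_def)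
  next
    case 2
    then have "ks = [i]" using m by simp
    then show ?thesis using 2 eq partial_deriv_f[OF z] by (simp add: partial2_def)
  next
    case 3
    have "length ks = 2" using mset_eq_length[OF m] 3 by simp
    then obtain x y where xy: "ks = [x, y]" by (auto simp: length_Suc_conv numeral_2_eq_2)
    then have "x = i \<and> y = j \<or> x = j \<and> y = i" using m 3 by (auto simp: add_eq_conv_ex)
    then show ?thesis using 3 xy eq partial_deriv2_f[OF z] G'_symmetric[OF z] by (auto simp: partial2_def)
  qed
qed

lemma partial2_cont: "length js \<le> 2 \<Longrightarrow> continuous_on D (partial2 js)"
  unfolding partial2_def[abs_def]
  by (cases js; cases "tl js") (auto intro!: continuous_intros f_cont G_cont G'_cont)

text \<open>A real \<open>SUP\<close> is known to dominate its members only for a set bounded above;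
  continuity of the partial derivatives on the compact disk provides this.\<close>

lemma partial2_le_C2_norm:
  assumes z: "z \<in> D" and len: "length js \<le> 2"
  shows "\<bar>partial2 js z\<bar> \<le> C2_norm D f"
proof -
  let ?A = "{\<alpha> :: 'n \<Rightarrow> nat. (\<Sum>i\<in>UNIV. \<alpha> i) \<le> 2}"
  let ?S = "\<lambda>z. sqrt (\<Sum>\<alpha>\<in>?A. \<bar>multi_partial D \<alpha> f z\<bar>\<^sup>2)"
  have "continuous_on D (multi_partial D \<alpha> f)" if \<alpha>: "\<alpha> \<in> ?A" for \<alpha>
  proof -
    obtain ks where ks: "\<alpha> = count_list ks" "length ks \<le> 2"
      using \<alpha> unfolding multi_indices_eq by blast
    show ?thesis
      by (rule continuous_on_eq[OF partial2_cont[OF ks(2)]]) (simp add: ks multi_partial_f)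
  qed
  then have "continuous_on D ?S" by (intro continuous_intros)
  then have "compact (?S ` D)" by (rule compact_continuous_image) simp
  then have bdd: "bdd_above (?S ` D)" by (intro bounded_imp_bdd_above compact_imp_bounded)
  have js: "count_list js \<in> ?A" using len unfolding multi_indices_eq by blast
  have "\<bar>partial2 js z\<bar> = sqrt (\<bar>multi_partial D (count_list js) f z\<bar>\<^sup>2)"
    by (simp add: multi_partial_f[OF z len])
  also have "\<dots> \<le> ?S z"
    by (intro real_sqrt_le_mono member_le_sum js finite_multi_indices) simp
  also have "\<dots> \<le> C2_norm D f" unfolding C2_norm_def by (rule cSUP_upper[OF z bdd])
  finally show ?thesis .
qed

text \<open>Norms are compared with sums of absolute entries, which costs one factor of the
  dimension for the vector and two for the operator. The square reappears in the normalised
  \<open>d\<close>.\<close>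

lemma C2_bounds:
  assumes z: "z \<in> D"
  shows "\<bar>f z\<bar> \<le> C2_norm D f" "norm (G z) \<le> real CARD('n) * C2_norm D f"
    "norm (G' z) \<le> (real CARD('n))\<^sup>2 * C2_norm D f"
proof -
  let ?M = "C2_norm D f"
  show "\<bar>f z\<bar> \<le> ?M" using partial2_le_C2_norm[OF z, of "[]"] by (simp add: partial2_def)
  then have M: "?M \<ge> 0" by simp
  have "\<bar>G z $ i\<bar> \<le> ?M" for i using partial2_le_C2_norm[OF z, of "[i]"] by (simp add: partial2_def)
  then have "(\<Sum>i\<in>UNIV. \<bar>G z $ i\<bar>) \<le> (\<Sum>i\<in>(UNIV :: 'n set). ?M)" by (intro sum_mono)
  then show "norm (G z) \<le> real CARD('n) * ?M" using norm_le_l1_cart[of "G z"] by simp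
  have entry: "\<bar>G' z (axis i 1) $ j\<bar> \<le> ?M" for i j
    using partial2_le_C2_norm[OF z, of "[i, j]"] by (simp add: partial2_def)
  have col: "norm (G' z (axis i 1)) \<le> real CARD('n) * ?M" for i
  proof -
    have "(\<Sum>j\<in>UNIV. \<bar>G' z (axis i 1) $ j\<bar>) \<le> (\<Sum>j\<in>(UNIV :: 'n set). ?M)" by (intro sum_mono entry)
    then show ?thesis using norm_le_l1_cart[of "G' z (axis i 1)"] by simp
  qed
  show "norm (G' z) \<le> (real CARD('n))\<^sup>2 * ?M"
  proof (rule norm_blinfun_bound)
    fix h :: "real^'n"
    have "G' z h = G' z (\<Sum>i\<in>UNIV. h $ i *\<^sub>R axis i 1)"
      using basis_expansion[of h] by (simp add: scalar_mult_eq_scaleR)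
    also have "\<dots> = (\<Sum>i\<in>UNIV. h $ i *\<^sub>R G' z (axis i 1))"
      by (simp add: blinfun.sum_right blinfun.scaleR_right)
    also have "norm \<dots> \<le> (\<Sum>i\<in>(UNIV :: 'n set). norm h * (real CARD('n) * ?M))"
      by (intro sum_norm_le) (auto intro!: mult_mono col component_le_norm_cart)
    also have "\<dots> = (real CARD('n))\<^sup>2 * ?M * norm h" by (simp add: power2_eq_square)
    finally show "norm (G' z h) \<le> (real CARD('n))\<^sup>2 * ?M * norm h" .
  qed (use M in simp)
qed

section \<open>The restriction to the sphere\<close>

lemma tangential_derivative:
  assumes z: "z \<in> sphere a r"
  obtains v where "v \<bullet> (z - a) = 0" "(f has_derivative (\<lambda>w. v \<bullet> w)) (at z within sphere a r)"
proof -
  \<comment> \<open>Subtracting a multiple of a function that vanishes on the sphere removes the normal part of \<open>G z\<close>.\<close>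
  define c where "c = G z \<bullet> (z - a) / r\<^sup>2"
  have norm_z: "(z - a) \<bullet> (z - a) = r\<^sup>2"
    using z by (simp add: power2_norm_eq_inner[symmetric] dist_norm norm_minus_commute)
  have "(f has_derivative (\<lambda>h. G z \<bullet> h)) (at z within sphere a r)"
    using has_derivative_subset[OF f_deriv[of z], of "sphere a r"] z by auto
  moreover have "((\<lambda>y. c / 2 * ((y - a) \<bullet> (y - a) - r\<^sup>2)) has_derivative (\<lambda>h. c * ((z - a) \<bullet> h))) (at z within sphere a r)"
    by (auto intro!: derivative_eq_intros simp: inner_commute)
  ultimately have "((\<lambda>y. f y - c / 2 * ((y - a) \<bullet> (y - a) - r\<^sup>2)) has_derivative
      (\<lambda>h. G z \<bullet> h - c * ((z - a) \<bullet> h))) (at z within sphere a r)"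
    by (rule has_derivative_diff)
  then have "((\<lambda>y. f y - c / 2 * ((y - a) \<bullet> (y - a) - r\<^sup>2)) has_derivative
      (\<lambda>h. (G z - c *\<^sub>R (z - a)) \<bullet> h)) (at z within sphere a r)"
    by (simp add: inner_diff_left)
  from has_derivative_transform[OF z _ this, of f]
  have "(f has_derivative (\<lambda>h. (G z - c *\<^sub>R (z - a)) \<bullet> h)) (at z within sphere a r)"
    by (simp add: power2_norm_eq_inner[symmetric] dist_norm norm_minus_commute)
  moreover have "(G z - c *\<^sub>R (z - a)) \<bullet> (z - a) = 0"
    using r norm_z by (simp add: c_def inner_diff_left)
  ultimately show ?thesis by (rule that[rotated])
qed

lemma tangential_derivative_at_extremum:
  assumes z: "z \<in> sphere a r" and ne: "f z \<noteq> 0" and min: "\<And>y. y \<in> sphere a r \<Longrightarrow> \<bar>f z\<bar> \<le> \<bar>f y\<bar>"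
    and v: "v \<bullet> (z - a) = 0" "(f has_derivative (\<lambda>w. v \<bullet> w)) (at z within sphere a r)"
  shows "v = 0"
proof (rule ccontr)
  assume v0: "v \<noteq> 0"
  define u where "u = (r / norm v) *\<^sub>R v"
  \<comment> \<open>A great circle through \<open>z\<close> with initial velocity \<open>u\<close>;
    since \<open>u\<close> is orthogonal to the radius and has length \<open>r\<close>, the curve
    stays on the sphere.\<close>
  define \<gamma> where "\<gamma> t = a + cos t *\<^sub>R (z - a) + sin t *\<^sub>R u" for t
  have zz: "(z - a) \<bullet> (z - a) = r\<^sup>2"
    using z by (simp add: power2_norm_eq_inner[symmetric] dist_norm norm_minus_commute)
  have uu: "u \<bullet> u = r\<^sup>2"
    using v0 by (simp add: u_def power2_norm_eq_inner[symmetric] power_divide)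
  have uz: "u \<bullet> (z - a) = 0" using v(1) by (simp add: u_def)
  have \<gamma>: "\<gamma> t \<in> sphere a r" for t
  proof -
    have "(norm (\<gamma> t - a))\<^sup>2 = (cos t)\<^sup>2 * r\<^sup>2 + (sin t)\<^sup>2 * r\<^sup>2"
      using uz unfolding power2_norm_eq_inner
      by (simp add: \<gamma>_def inner_add_left inner_add_right zz uu inner_commute[of "z - a" u]
          power2_eq_square[of "cos t"] power2_eq_square[of "sin t"])
    also have "\<dots> = r\<^sup>2" by (simp add: distrib_right[symmetric])
    finally have "norm (\<gamma> t - a) = r" using r by (simp add: power2_eq_iff_nonneg)
    then show ?thesis by (simp add: dist_norm norm_minus_commute)
  qed
  have \<gamma>0: "\<gamma> 0 = z" by (simp add: \<gamma>_def)
  have "(\<gamma> has_derivative (\<lambda>h. h *\<^sub>R u)) (at 0)"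
    unfolding \<gamma>_def[abs_def] by (auto intro!: derivative_eq_intros)
  moreover have "(f has_derivative (\<lambda>w. v \<bullet> w)) (at (\<gamma> 0) within range \<gamma>)"
    unfolding \<gamma>0 by (rule has_derivative_subset[OF v(2)]) (use \<gamma> in auto)
  ultimately have "((f \<circ> \<gamma>) has_derivative ((\<lambda>w. v \<bullet> w) \<circ> (\<lambda>h. h *\<^sub>R u))) (at 0)"
    by (rule diff_chain_within)
  then have "((\<lambda>t. f (\<gamma> t)) has_derivative (\<lambda>h. (v \<bullet> u) * h)) (at 0)"
    by (simp add: o_def mult.commute)
  then have "DERIV (\<lambda>t. f (\<gamma> t)) 0 :> v \<bullet> u" by (simp add: has_field_derivative_def)
  \<comment> \<open>Squaring makes the minimum of \<open>\<bar>f\<bar>\<close> a differentiable minimum whatever the sign of \<open>f z\<close>.\<close>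
  from DERIV_mult[OF this this]
  have deriv: "DERIV (\<lambda>t. f (\<gamma> t) * f (\<gamma> t)) 0 :> 2 * (v \<bullet> u) * f z" by (simp add: \<gamma>0 mult_ac)
  have "f (\<gamma> 0) * f (\<gamma> 0) \<le> f (\<gamma> t) * f (\<gamma> t)" for t
    using min[OF \<gamma>[of t]] unfolding \<gamma>0 by (simp add: abs_le_square_iff power2_eq_square)
  then have "2 * (v \<bullet> u) * f z = 0"
    by (intro DERIV_local_min[OF deriv zero_less_one] allI impI)
  then have "v \<bullet> u = 0" using ne by simp
  then show False using v0 r by (simp add: u_def)
qed

text \<open>The definite description needs existence and uniqueness. At an extremum both are at
  hand: a tangential derivative exists, and every candidate vanishes.\<close>

lemma sphere_gradient_at_extremum:
  assumes "z \<in> sphere a r" "f z \<noteq> 0" "\<And>y. y \<in> sphere a r \<Longrightarrow> \<bar>f z\<bar> \<le> \<bar>f y\<bar>"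
  shows "sphere_gradient a r f z = 0"
proof -
  have zero: "v = 0" if "v \<bullet> (z - a) = 0" "(f has_derivative (\<lambda>w. v \<bullet> w)) (at z within sphere a r)" for v
    by (rule tangential_derivative_at_extremum[OF assms that])
  obtain v where v: "v \<bullet> (z - a) = 0" "(f has_derivative (\<lambda>w. v \<bullet> w)) (at z within sphere a r)"
    using tangential_derivative[OF assms(1)] by blast
  show ?thesis unfolding sphere_gradient_def
  proof (rule the_equality)
    show "0 \<bullet> (z - a) = 0 \<and> (f has_derivative (\<bullet>) 0) (at z within sphere a r)"
      using v unfolding zero[OF v] by (rule conjI)
    show "w = 0" if "w \<bullet> (z - a) = 0 \<and> (f has_derivative (\<bullet>) w) (at z within sphere a r)" for w
      using that zero by blast
  qed
qed

lemma normalised_multiple: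
  assumes reg: "regular_eq a r f" and int: "zero_set D f \<subseteq> interior D"
    and \<kappa>: "kappa2 a r f \<le> \<kappa>" "\<kappa> > 0"
  obtains c where "c \<noteq> 0"
    "normalised a r (1 / ((real CARD('n))\<^sup>2 * \<kappa>)) (\<lambda>z. c * f z) (\<lambda>z. c *\<^sub>R G z) (\<lambda>z. c *\<^sub>R G' z)"
proof -
  let ?M = "C2_norm D f" and ?n = "real CARD('n)" and ?\<delta> = "delta a r f"
  have n: "?n \<ge> 1" by (simp add: Suc_leI)
  have sD: "sphere a r \<subseteq> D" by auto
  obtain b :: "real^'n" where "b \<in> Basis" by fastforce
  then have "a + r *\<^sub>R b \<in> sphere a r" using r by (simp add: dist_norm)
  then have sne: "sphere a r \<noteq> {}" by blast
  have f_sphere: "f z \<noteq> 0" if "z \<in> sphere a r" for z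
    using that int interior_cball[of a r] by (auto simp: zero_set_def)
  have "continuous_on (sphere a r) (\<lambda>z. \<bar>f z\<bar>)"
    by (intro continuous_intros continuous_on_subset[OF f_cont sD])
  then obtain p where p: "p \<in> sphere a r" "\<And>y. y \<in> sphere a r \<Longrightarrow> \<bar>f p\<bar> \<le> \<bar>f y\<bar>"
    using continuous_attains_inf[of "sphere a r" "\<lambda>z. \<bar>f z\<bar>"] sne by auto
  let ?i = "\<lambda>z. sqrt (\<bar>f z\<bar>\<^sup>2 + (norm (gradient D f z))\<^sup>2)"
  let ?s = "\<lambda>z. sqrt (\<bar>f z\<bar>\<^sup>2 + (norm (sphere_gradient a r f z))\<^sup>2)"
  have bdd: "bdd_below (?i ` D)" "bdd_below (?s ` sphere a r)"
    by (auto intro!: bdd_belowI[of _ 0])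
  have Dne: "D \<noteq> {}" using r by simp
  have "continuous_on D (\<lambda>z. sqrt (\<bar>f z\<bar>\<^sup>2 + (norm (G z))\<^sup>2))"
    by (intro continuous_intros f_cont G_cont)
  then obtain q where q: "q \<in> D"
    "\<And>y. y \<in> D \<Longrightarrow> sqrt (\<bar>f q\<bar>\<^sup>2 + (norm (G q))\<^sup>2) \<le> sqrt (\<bar>f y\<bar>\<^sup>2 + (norm (G y))\<^sup>2)"
    using continuous_attains_inf[of D "\<lambda>z. sqrt (\<bar>f z\<bar>\<^sup>2 + (norm (G z))\<^sup>2)"] Dne by auto
  \<comment> \<open>A quotient by 0 is 0, so \<open>kappa2 a r f \<le> \<kappa>\<close> would say
    nothing if \<open>delta\<close> vanished. Its positivity has to come from regularity at a point
    where the infimum over the disk is attained, and on the sphere from the absence of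
    zeros.\<close>
  have "?i q > 0"
  proof (cases "f q = 0")
    case True
    then have "gradient D f q \<noteq> 0" using reg q(1) by (auto simp: regular_eq_def)
    then show ?thesis by (simp add: add_nonneg_pos)
  qed (simp add: add_pos_nonneg)
  also have "?i q \<le> (INF z\<in>D. ?i z)"
    using q Dne by (intro cINF_greatest) (auto simp: gradient_f)
  finally have "0 < (INF z\<in>D. ?i z)" .
  moreover have "0 < \<bar>f p\<bar>" using f_sphere[OF p(1)] by simp
  then have "0 < (INF z\<in>sphere a r. ?s z)"
  proof (rule less_le_trans)
    show "\<bar>f p\<bar> \<le> (INF z\<in>sphere a r. ?s z)"
    proof (rule cINF_greatest[OF sne])
      fix z assume "z \<in> sphere a r"
      then have "\<bar>f p\<bar> \<le> \<bar>f z\<bar>" by (rule p(2))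
      also have "\<dots> = sqrt (\<bar>f z\<bar>\<^sup>2)" by simp
      also have "\<dots> \<le> ?s z" by (rule real_sqrt_le_mono) simp
      finally show "\<bar>f p\<bar> \<le> ?s z" .
    qed
  qed
  ultimately have \<delta>: "?\<delta> > 0" by (simp only: delta_def min_less_iff_conj)
  have M\<delta>: "?M / \<kappa> \<le> ?\<delta>"
    using \<kappa> \<delta> by (simp add: kappa2_def pos_divide_le_eq mult.commute)
  have int_bound: "(?M / \<kappa>)\<^sup>2 \<le> (f z)\<^sup>2 + (norm (G z))\<^sup>2" if z: "z \<in> D" for z
  proof -
    have "?\<delta> \<le> (INF z\<in>D. ?i z)" by (simp add: delta_def)
    also have "\<dots> \<le> ?i z" by (rule cINF_lower[OF bdd(1) z])
    finally have "?M / \<kappa> \<le> sqrt (\<bar>f z\<bar>\<^sup>2 + (norm (G z))\<^sup>2)" using M\<delta> by (simp add: gradient_f[OF z])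
    moreover have "0 \<le> ?M / \<kappa>" using C2_bounds(1)[OF z] \<kappa>(2) by simp
    ultimately have "(?M / \<kappa>)\<^sup>2 \<le> (sqrt (\<bar>f z\<bar>\<^sup>2 + (norm (G z))\<^sup>2))\<^sup>2" by (rule power_mono)
    then show ?thesis by simp
  qed
  have sphere_bound: "?M / \<kappa> \<le> \<bar>f z\<bar>" if z: "z \<in> sphere a r" for z
  proof -
    have "?\<delta> \<le> (INF z\<in>sphere a r. ?s z)" by (simp add: delta_def)
    also have "\<dots> \<le> ?s p" by (rule cINF_lower[OF bdd(2) p(1)])
    also have "\<dots> = \<bar>f p\<bar>" using sphere_gradient_at_extremum[OF p(1) f_sphere[OF p(1)] p(2)] by simp
    also have "\<dots> \<le> \<bar>f z\<bar>" by (rule p(2)[OF z])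
    finally show ?thesis using M\<delta> by simp
  qed
  have "0 < \<bar>f p\<bar>" using f_sphere[OF p(1)] by simp
  also have "\<dots> \<le> ?M" using p(1) sD by (intro C2_bounds) auto
  finally have M: "?M > 0" .
  \<comment> \<open>\<open>?n\<^sup>2 * ?M\<close> dominates the bounds for value, gradient and
    second derivative, so one scaling brings all three below 1 and turns
    \<open>?M / \<kappa>\<close> into \<open>1 / (?n\<^sup>2 * \<kappa>)\<close>.\<close>
  define c where "c = 1 / (?n\<^sup>2 * ?M)"
  have c: "c > 0" using M n by (simp add: c_def)
  have cM: "c * (?n\<^sup>2 * ?M) = 1" using M n by (simp add: c_def)
  have cMn: "c * (?n * ?M) \<le> 1" "c * ?M \<le> 1"
  proof -
    have "?n \<le> ?n\<^sup>2" "1 \<le> ?n\<^sup>2" using n self_le_power[of ?n 2] by auto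
    then have "c * (?n * ?M) \<le> c * (?n\<^sup>2 * ?M)" "c * (1 * ?M) \<le> c * (?n\<^sup>2 * ?M)"
      using c M by (auto intro!: mult_left_mono mult_right_mono)
    then show "c * (?n * ?M) \<le> 1" "c * ?M \<le> 1" using cM by simp_all
  qed
  have d: "1 / (?n\<^sup>2 * \<kappa>) = c * (?M / \<kappa>)" using M by (simp add: c_def)
  have "normalised a r (1 / (?n\<^sup>2 * \<kappa>)) (\<lambda>z. c * f z) (\<lambda>z. c *\<^sub>R G z) (\<lambda>z. c *\<^sub>R G' z)"
    unfolding normalised_def
  proof (intro conjI ballI)
    fix z assume z: "z \<in> D"
    show "((\<lambda>z. c * f z) has_derivative (\<lambda>h. c *\<^sub>R G z \<bullet> h)) (at z within D)"
      using has_derivative_mult_right[OF f_deriv[OF z], of c] by simp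
    show "((\<lambda>z. c *\<^sub>R G z) has_derivative blinfun_apply (c *\<^sub>R G' z)) (at z within D)"
      using has_derivative_scaleR_right[OF G_deriv[OF z], of c]
      by (rule has_derivative_eq_rhs) (simp add: fun_eq_iff blinfun.scaleR_left)
    have b: "c * \<bar>f z\<bar> \<le> c * ?M" "c * norm (G z) \<le> c * (?n * ?M)" "c * norm (G' z) \<le> c * (?n\<^sup>2 * ?M)"
      using c C2_bounds[OF z] by (auto intro!: mult_left_mono)
    show "\<bar>c * f z\<bar> \<le> 1" using order_trans[OF b(1) cMn(2)] c by (simp add: abs_mult)
    show "norm (c *\<^sub>R G z) \<le> 1" using order_trans[OF b(2) cMn(1)] c by simp
    show "norm (c *\<^sub>R G' z) \<le> 1" using order_trans[OF b(3) eq_refl[OF cM]] c by simp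
    have "c\<^sup>2 * (?M / \<kappa>)\<^sup>2 \<le> c\<^sup>2 * ((f z)\<^sup>2 + (norm (G z))\<^sup>2)" by (intro mult_left_mono int_bound z) simp
    then show "(1 / (?n\<^sup>2 * \<kappa>))\<^sup>2 \<le> (c * f z)\<^sup>2 + (norm (c *\<^sub>R G z))\<^sup>2"
      unfolding d norm_scaleR power_mult_distrib power2_abs distrib_left .
  next
    show "continuous_on D (\<lambda>z. c *\<^sub>R G' z)" by (intro continuous_intros G'_cont)
  next
    fix z assume z: "z \<in> sphere a r"
    have "c * (?M / \<kappa>) \<le> c * \<bar>f z\<bar>" using c by (intro mult_left_mono sphere_bound z) simp
    then show "1 / (?n\<^sup>2 * \<kappa>) \<le> \<bar>c * f z\<bar>" unfolding d using c by (simp add: abs_mult)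
  qed
  with c show ?thesis by (intro that) auto
qed

end

lemma zero_sets_normalised:
  fixes a :: "real^'n"
  assumes r: "r > 0" and \<kappa>: "\<kappa> > 0" and K: "K \<in> zero_sets a r \<kappa>"
  obtains F G G' where "normalised a r (1 / ((real CARD('n))\<^sup>2 * \<kappa>)) F G G'" "K = zero_set (cball a r) F"
proof -
  from K obtain f where f: "K = zero_set (cball a r) f" "C2_on (cball a r) f" "regular_eq a r f"
    "zero_set (cball a r) f \<subseteq> interior (cball a r)" "kappa2 a r f \<le> \<kappa>"
    by (auto simp: zero_sets_def)
  obtain G G' where G: "\<And>z. z \<in> cball a r \<Longrightarrow> (f has_derivative (\<lambda>h. G z \<bullet> h)) (at z within cball a r)"
    "\<And>z. z \<in> cball a r \<Longrightarrow> (G has_derivative blinfun_apply (G' z)) (at z within cball a r)"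
    "continuous_on (cball a r) G'"
    using C2_on_obtain[OF f(2)] by blast
  interpret C2_function a r f G G' by unfold_locales (fact r G)+
  obtain c where c: "c \<noteq> 0"
    "normalised a r (1 / ((real CARD('n))\<^sup>2 * \<kappa>)) (\<lambda>z. c * f z) (\<lambda>z. c *\<^sub>R G z) (\<lambda>z. c *\<^sub>R G' z)"
    using normalised_multiple[OF f(3-5) \<kappa>] by blast
  have "K = zero_set (cball a r) (\<lambda>z. c * f z)" using c(1) f(1) by (auto simp: zero_set_def)
  with c(2) show ?thesis by (rule that)
qed

section \<open>Counting\<close>

lemma card_quotient_le_code:
  assumes R: "equiv S R" and A: "A \<subseteq> S" and C: "finite C" and code: "code ` A \<subseteq> C"
    and rel: "\<And>x y. x \<in> A \<Longrightarrow> y \<in> A \<Longrightarrow> code x = code y \<Longrightarrow> (x, y) \<in> R"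
  shows "finite (A // R)" "card (A // R) \<le> card C"
proof -
  define h where "h c = R `` {SOME x. x \<in> A \<and> code x = c}" for c
  have "A // R \<subseteq> h ` C"
  proof
    fix X assume "X \<in> A // R"
    then obtain x where x: "x \<in> A" "X = R `` {x}" by (rule quotientE)
    define y where "y = (SOME y. y \<in> A \<and> code y = code x)"
    have y: "y \<in> A \<and> code y = code x" unfolding y_def by (rule someI[of _ x]) (use x in simp)
    then have "(x, y) \<in> R" using rel[of x y] x(1) by simp
    then have "X = h (code x)" unfolding x(2) h_def y_def[symmetric] by (rule equiv_class_eq[OF R])
    then show "X \<in> h ` C" using code x(1) by blast
  qed
  then show "finite (A // R)" "card (A // R) \<le> card C"
    using C finite_surj[of C "A // R" h] surj_card_le[of C "A // R" h] by auto
qed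

lemma floor_divide_eq_imp_close:
  fixes x y e :: real
  assumes "e > 0" "\<lfloor>x / e\<rfloor> = \<lfloor>y / e\<rfloor>"
  shows "\<bar>x - y\<bar> \<le> e"
proof -
  have "\<bar>x / e - y / e\<bar> \<le> 1" using assms(2) by linarith
  then have "\<bar>(x - y) / e\<bar> \<le> 1" by (simp add: diff_divide_distrib)
  then show ?thesis using assms(1) by (simp add: pos_divide_le_eq)
qed

lemma floor_divide_bound:
  fixes x b e :: real
  assumes "e > 0" "\<bar>x\<bar> \<le> b"
  shows "\<lfloor>x / e\<rfloor> \<in> {- \<lceil>b / e\<rceil>..\<lceil>b / e\<rceil>}"
proof -
  have "x / e \<le> b / e" "- (b / e) \<le> x / e"
    using assms divide_right_mono[of x b e] divide_right_mono[of "- b" x e] by auto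
  then show ?thesis by (simp add: le_floor_iff) linarith
qed

lemma norm_vec_le_card:
  fixes v :: "real^'n" assumes "\<And>i. \<bar>v $ i\<bar> \<le> e"
  shows "norm v \<le> real CARD('n) * e"
proof -
  have "(\<Sum>i\<in>UNIV. \<bar>v $ i\<bar>) \<le> (\<Sum>i\<in>(UNIV :: 'n set). e)" by (intro sum_mono assms)
  then show ?thesis using norm_le_l1_cart[of v] by simp
qed

text \<open>The gradients differ by \<open>n * e\<close> at \<open>p\<close>, and each changes by at
  most \<open>n * e\<close> on the way to \<open>z\<close>. The mean value inequality over the
  distance \<open>n * e\<close> then costs only order \<open>e\<^sup>2\<close> in the values, so one
  sample of precision \<open>e\<^sup>2\<close> per cell suffices.\<close>

lemma close_on_cell:
  fixes F g :: "real^'n \<Rightarrow> real"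
  assumes F: "normalised a r d F G G'" and g: "normalised a r d g \<Gamma> \<Gamma>'"
    and p: "p \<in> cball a r" and z: "z \<in> cball a r" and e: "e > 0"
    and zp: "norm (z - p) \<le> n * e" and n: "n \<ge> 1"
    and v: "\<bar>g p - F p\<bar> \<le> e\<^sup>2" and dv: "norm (\<Gamma> p - G p) \<le> n * e"
  shows "\<bar>g z - F z\<bar> \<le> 4 * n\<^sup>2 * e\<^sup>2" "norm (\<Gamma> z - G z) \<le> 3 * n * e"
proof -
  have grad: "norm (\<Gamma> x - G x) \<le> 3 * n * e" if x: "x \<in> cball a r" "norm (x - p) \<le> n * e" for x
  proof -
    have "\<Gamma> x - G x = (\<Gamma> p - G p) + (\<Gamma> x - \<Gamma> p) + (G p - G x)" by simp
    also have "norm \<dots> \<le> n * e + n * e + n * e"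
      using normalised_lipschitz(2)[OF F p x(1)] normalised_lipschitz(2)[OF g x(1) p] x(2) dv
      by (intro norm_triangle_le add_mono) (auto simp: norm_minus_commute)
    finally show ?thesis by (simp add: mult_ac)
  qed
  then show "norm (\<Gamma> z - G z) \<le> 3 * n * e" using z zp by blast
  let ?S = "cball a r \<inter> cball p (n * e)"
  have "norm ((g z - F z) - (g p - F p)) \<le> 3 * n * e * norm (z - p)"
  proof (rule differentiable_bound[where S = ?S and f' = "\<lambda>x h. (\<Gamma> x - G x) \<bullet> h"])
    show "convex ?S" by (intro convex_Int convex_cball)
    show "z \<in> ?S" "p \<in> ?S" using z zp p n e by (auto simp: dist_norm norm_minus_commute)
    fix x assume x: "x \<in> ?S"
    then have "(F has_derivative (\<lambda>h. G x \<bullet> h)) (at x within ?S)" "(g has_derivative (\<lambda>h. \<Gamma> x \<bullet> h)) (at x within ?S)"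
      using F g by (auto simp: normalised_def intro: has_derivative_subset)
    from has_derivative_diff[OF this(2,1)]
    show "((\<lambda>x. g x - F x) has_derivative (\<lambda>h. (\<Gamma> x - G x) \<bullet> h)) (at x within ?S)"
      by (simp add: inner_diff_left)
    show "onorm (\<lambda>h. (\<Gamma> x - G x) \<bullet> h) \<le> 3 * n * e"
    proof (rule onorm_le)
      fix h
      have "norm (\<Gamma> x - G x) \<le> 3 * n * e"
        using x by (intro grad) (auto simp: dist_norm norm_minus_commute)
      from order_trans[OF Cauchy_Schwarz_ineq2 mult_right_mono[OF this norm_ge_zero]]
      show "norm ((\<Gamma> x - G x) \<bullet> h) \<le> 3 * n * e * norm h" by simp
    qed
  qed
  also have "\<dots> \<le> 3 * n * e * (n * e)" using zp n e by (intro mult_left_mono) auto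
  finally have "norm ((g z - F z) - (g p - F p)) + \<bar>g p - F p\<bar> \<le> 3 * n * e * (n * e) + e\<^sup>2"
    using v by (rule add_mono)
  then have "\<bar>g z - F z\<bar> \<le> 3 * n * e * (n * e) + e\<^sup>2" by (auto simp: abs_if split: if_splits)
  also have "\<dots> \<le> 3 * n * e * (n * e) + n\<^sup>2 * e\<^sup>2"
    using n by (intro add_left_mono) (simp add: mult_le_cancel_right1)
  also have "\<dots> = 4 * n\<^sup>2 * e\<^sup>2" by (simp add: power2_eq_square)
  finally show "\<bar>g z - F z\<bar> \<le> 4 * n\<^sup>2 * e\<^sup>2" .
qed

section \<open>Grid cells and rounded 1-jets\<close>

definition cell :: "real^'n \<Rightarrow> real \<Rightarrow> real^'n \<Rightarrow> 'n \<Rightarrow> int" where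
  "cell a e z = (\<lambda>i. \<lfloor>(z $ i - a $ i) / e\<rfloor>)"

lemma cell_eq_imp_close:
  fixes y z :: "real^'n"
  assumes "e > 0" "cell a e y = cell a e z"
  shows "norm (z - y) \<le> real CARD('n) * e"
proof (rule norm_vec_le_card)
  fix i
  have "\<lfloor>(z $ i - a $ i) / e\<rfloor> = \<lfloor>(y $ i - a $ i) / e\<rfloor>"
    using fun_cong[OF assms(2), of i] by (simp add: cell_def)
  from floor_divide_eq_imp_close[OF assms(1) this] show "\<bar>(z - y) $ i\<bar> \<le> e" by simp
qed

lemma cells_of_cball:
  fixes a :: "real^'n"
  assumes e: "0 < e" "e \<le> 1" and r: "r > 0"
  shows "finite (cell a e ` cball a r)"
    "real (card (cell a e ` cball a r)) \<le> ((2 * r + 3) / e) ^ CARD('n)"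
proof -
  let ?m = "\<lceil>r / e\<rceil>"
  let ?P = "\<Pi>\<^sub>E i\<in>(UNIV :: 'n set). {- ?m..?m}"
  have sub: "cell a e ` cball a r \<subseteq> ?P"
  proof (rule image_subsetI)
    fix z assume z: "z \<in> cball a r"
    have "\<bar>z $ i - a $ i\<bar> \<le> r" for i
      using z component_le_norm_cart[of "z - a" i] by (simp add: dist_norm norm_minus_commute)
    from floor_divide_bound[OF e(1) this] show "cell a e z \<in> ?P" by (auto simp: cell_def)
  qed
  have fin: "finite ?P" by (intro finite_PiE) auto
  show "finite (cell a e ` cball a r)" using finite_subset[OF sub fin] .
  have m: "?m \<ge> 0" using divide_pos_pos[OF r e(1)] by linarith
  have "real (card (cell a e ` cball a r)) \<le> real (card ?P)" using card_mono[OF fin sub] by simp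
  also have "\<dots> = (2 * real_of_int ?m + 1) ^ CARD('n)" using m by (simp add: card_PiE)
  also have "\<dots> \<le> ((2 * r + 3) / e) ^ CARD('n)"
  proof (rule power_mono)
    \<comment> \<open>Rounding up costs 2 and the index 0 costs 1; as \<open>e \<le> 1\<close>,
      these 3 are at most \<open>3 / e\<close>.\<close>
    have "real_of_int ?m \<le> r / e + 1" by linarith
    then have "2 * real_of_int ?m + 1 \<le> 2 * (r / e) + 3" by linarith
    also have "\<dots> \<le> 2 * (r / e) + 3 / e" using e by (simp add: pos_le_divide_eq)
    also have "\<dots> = (2 * r + 3) / e" by (simp add: add_divide_distrib)
    finally show "2 * real_of_int ?m + 1 \<le> (2 * r + 3) / e" .
  qed (use m in simp)
  finally show "real (card (cell a e ` cball a r)) \<le> ((2 * r + 3) / e) ^ CARD('n)" .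
qed

text \<open>The sample point is chosen inside the disk because a cell may stick out of it. It does
  not depend on the equation, so all equations are sampled at the same points.\<close>

definition cell_point :: "real^'n \<Rightarrow> real \<Rightarrow> real \<Rightarrow> ('n \<Rightarrow> int) \<Rightarrow> real^'n" where
  "cell_point a r e c = (SOME z. z \<in> cball a r \<and> cell a e z = c)"

lemma cell_point:
  assumes "c \<in> cell a e ` cball a r"
  shows "cell_point a r e c \<in> cball a r" "cell a e (cell_point a r e c) = c"
proof -
  have "\<exists>z. z \<in> cball a r \<and> cell a e z = c" using assms by blast
  from someI_ex[OF this] show "cell_point a r e c \<in> cball a r" "cell a e (cell_point a r e c) = c"
    by (auto simp: cell_point_def)
qed

text \<open>Restriction to the cells that occur makes codes extensional functions, so that they lie
  in a finite product.\<close>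

definition jet_code ::
  "real^'n \<Rightarrow> real \<Rightarrow> real \<Rightarrow> (real^'n \<Rightarrow> real) \<Rightarrow> (real^'n \<Rightarrow> real^'n) \<Rightarrow> ('n \<Rightarrow> int) \<Rightarrow> int \<times> ('n \<Rightarrow> int)" where
  "jet_code a r e F G = (\<lambda>c\<in>cell a e ` cball a r.
     (\<lfloor>F (cell_point a r e c) / e\<^sup>2\<rfloor>, \<lambda>i. \<lfloor>G (cell_point a r e c) $ i / e\<rfloor>))"

definition jet_codes :: "real^'n \<Rightarrow> real \<Rightarrow> real \<Rightarrow> (('n \<Rightarrow> int) \<Rightarrow> int \<times> ('n \<Rightarrow> int)) set" where
  "jet_codes a r e = (\<Pi>\<^sub>E c\<in>cell a e ` cball a r.
     {- \<lceil>1 / e\<^sup>2\<rceil>..\<lceil>1 / e\<^sup>2\<rceil>} \<times> (\<Pi>\<^sub>E i\<in>UNIV. {- \<lceil>1 / e\<rceil>..\<lceil>1 / e\<rceil>}))"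

lemma jet_code_in:
  fixes a :: "real^'n"
  assumes "normalised a r d F G G'" "e > 0"
  shows "jet_code a r e F G \<in> jet_codes a r e"
  unfolding jet_code_def jet_codes_def
proof (rule restrict_PiE_iff[THEN iffD2], intro ballI)
  fix c assume "c \<in> cell a e ` cball a r"
  then have p: "cell_point a r e c \<in> cball a r" by (rule cell_point)
  then have "\<bar>F (cell_point a r e c)\<bar> \<le> 1" "norm (G (cell_point a r e c)) \<le> 1"
    using assms(1) by (auto simp: normalised_def)
  moreover have "\<bar>G (cell_point a r e c) $ i\<bar> \<le> 1" for i
    using component_le_norm_cart[of "G (cell_point a r e c)" i] calculation(2) by simp
  ultimately show "(\<lfloor>F (cell_point a r e c) / e\<^sup>2\<rfloor>, \<lambda>i. \<lfloor>G (cell_point a r e c) $ i / e\<rfloor>)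
      \<in> {- \<lceil>1 / e\<^sup>2\<rceil>..\<lceil>1 / e\<^sup>2\<rceil>} \<times> (\<Pi>\<^sub>E i\<in>UNIV. {- \<lceil>1 / e\<rceil>..\<lceil>1 / e\<rceil>})"
    using floor_divide_bound[OF assms(2), of _ 1] floor_divide_bound[of "e\<^sup>2" _ 1] assms(2)
    by (simp add: PiE_UNIV_domain)
qed

lemma jet_codes_finite:
  assumes "0 < e" "e \<le> 1" "r > 0"
  shows "finite (jet_codes a r e)"
  unfolding jet_codes_def
  by (intro finite_PiE cells_of_cball assms finite_cartesian_product finite_atLeastAtMost_int finite)

text \<open>Each cell carries one value and \<open>CARD('n)\<close> gradient components. The range
  of a component, of order \<open>1 / e\<close>, is enlarged to that of a value, so all factors
  share the bound \<open>5 / e\<^sup>2\<close>.\<close>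

lemma card_jet_codes:
  fixes a :: "real^'n"
  assumes e: "0 < e" "e \<le> 1" and r: "r > 0"
  shows "real (card (jet_codes a r e)) \<le> (5 / e\<^sup>2) ^ ((CARD('n) + 1) * card (cell a e ` cball a r))"
proof -
  have bound: "2 * real_of_int \<lceil>b\<rceil> + 1 \<le> 5 * B" if "b \<le> B" "1 \<le> B" for b B :: real
    using that by linarith
  have e2: "1 \<le> 1 / e\<^sup>2" "1 / e \<le> 1 / e\<^sup>2"
  proof -
    have "e * e \<le> e * 1" using e by (intro mult_left_mono) auto
    then have "e\<^sup>2 \<le> e" by (simp add: power2_eq_square)
    then show "1 \<le> 1 / e\<^sup>2" "1 / e \<le> 1 / e\<^sup>2"
      using e by (auto simp: pos_le_divide_eq intro!: divide_left_mono)
  qed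
  have e1: "1 / e > 0" using e by simp
  have pos: "\<lceil>1 / e\<^sup>2\<rceil> \<ge> 0" "\<lceil>1 / e\<rceil> \<ge> 0" using e2(1) e1 by linarith+
  have "real (card (jet_codes a r e)) =
      ((2 * real_of_int \<lceil>1 / e\<^sup>2\<rceil> + 1) * (2 * real_of_int \<lceil>1 / e\<rceil> + 1) ^ CARD('n)) ^ card (cell a e ` cball a r)"
    unfolding jet_codes_def using pos cells_of_cball(1)[OF e r, of a]
    by (simp add: card_PiE card_cartesian_product)
  also have "\<dots> \<le> ((5 * (1 / e\<^sup>2)) * (5 * (1 / e\<^sup>2)) ^ CARD('n)) ^ card (cell a e ` cball a r)"
    using pos bound[of "1 / e\<^sup>2" "1 / e\<^sup>2"] bound[of "1 / e" "1 / e\<^sup>2"] e2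
    by (intro power_mono mult_mono) auto
  also have "\<dots> = (5 / e\<^sup>2) ^ ((CARD('n) + 1) * card (cell a e ` cball a r))"
    unfolding power_mult by simp
  finally show ?thesis .
qed

text \<open>The mesh is tuned to the gradients, for which the bound \<open>3 * CARD('n) * e\<close>
  is exactly \<open>d / 400\<close>; the values then agree to \<open>d\<^sup>2 / 360000\<close>,
  well within tolerance.\<close>

lemma same_jet_code_imp_close:
  fixes a :: "real^'n"
  assumes F: "normalised a r d F G G'" and g: "normalised a r d g \<Gamma> \<Gamma>'" and d: "d > 0"
    and e: "e = d / (1200 * real CARD('n))"
    and code: "jet_code a r e F G = jet_code a r e g \<Gamma>" and z: "z \<in> cball a r"
  shows "\<bar>g z - F z\<bar> \<le> d\<^sup>2 / 400" "norm (\<Gamma> z - G z) \<le> d / 400"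
proof -
  let ?n = "real CARD('n)" and ?c = "cell a e z"
  define p where "p = cell_point a r e ?c"
  have n: "?n \<ge> 1" by (simp add: Suc_leI)
  have e0: "e > 0" using d n by (simp add: e)
  have c: "?c \<in> cell a e ` cball a r" using z by blast
  note p = cell_point[OF c, folded p_def]
  have eq: "\<lfloor>g p / e\<^sup>2\<rfloor> = \<lfloor>F p / e\<^sup>2\<rfloor>" "\<And>i. \<lfloor>\<Gamma> p $ i / e\<rfloor> = \<lfloor>G p $ i / e\<rfloor>"
    using fun_cong[OF code, of ?c] c by (simp_all add: jet_code_def p_def[symmetric] fun_eq_iff)
  have "\<bar>g p - F p\<bar> \<le> e\<^sup>2" using floor_divide_eq_imp_close[OF _ eq(1)] e0 by simp
  moreover have "norm (\<Gamma> p - G p) \<le> ?n * e"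
    by (rule norm_vec_le_card) (use floor_divide_eq_imp_close[OF e0 eq(2)] in simp)
  moreover have "norm (z - p) \<le> ?n * e" by (rule cell_eq_imp_close[OF e0 p(2)])
  ultimately have 1: "\<bar>g z - F z\<bar> \<le> 4 * ?n\<^sup>2 * e\<^sup>2" "norm (\<Gamma> z - G z) \<le> 3 * ?n * e"
    using close_on_cell[OF F g p(1) z e0 _ n] by blast+
  have ne: "?n * e = d / 1200" using n by (simp add: e)
  have "4 * ?n\<^sup>2 * e\<^sup>2 = 4 * (?n * e)\<^sup>2" by (simp add: power_mult_distrib)
  also have "\<dots> \<le> d\<^sup>2 / 400" unfolding ne by (simp add: power_divide)
  finally show "\<bar>g z - F z\<bar> \<le> d\<^sup>2 / 400" using 1(1) by simp
  show "norm (\<Gamma> z - G z) \<le> d / 400" using 1(2) ne by simp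
qed

text \<open>The cube of the dimension in \<open>e\<close> is a square from the normalisation and one
  factor from the bound \<open>CARD('n) * e\<close> for distances within a cell.\<close>

lemma isotopy_classes_bound:
  fixes a :: "real^'n"
  assumes r: "r > 0" and \<kappa>: "\<kappa> \<ge> 1" and e: "e = 1 / (1200 * real CARD('n) ^ 3 * \<kappa>)"
  shows "finite (isotopy_classes a r \<kappa>)"
    "real (card (isotopy_classes a r \<kappa>)) \<le> (5 / e\<^sup>2) ^ ((CARD('n) + 1) * card (cell a e ` cball a r))"
proof -
  let ?n = "real CARD('n)" and ?D = "cball a r" and ?Z = "zero_sets a r \<kappa>"
  define d where "d = 1 / (?n\<^sup>2 * \<kappa>)"
  have n: "?n \<ge> 1" by (simp add: Suc_leI)
  have d: "d > 0" using n \<kappa> by (simp add: d_def)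
  have \<kappa>0: "\<kappa> > 0" using \<kappa> by simp
  have ed: "e = d / (1200 * ?n)" by (simp add: e d_def power2_eq_square power3_eq_cube mult_ac)
  have "1 \<le> ?n ^ 3 * \<kappa>" using mult_mono[of 1 "?n ^ 3" 1 \<kappa>] n \<kappa> by (simp add: one_le_power)
  then have e01: "0 < e" "e \<le> 1" using n \<kappa> by (simp_all add: e divide_le_eq_1)
  \<comment> \<open>One normalised equation is fixed for each zero set: many equations share a zero
    set, and the code reads the equation.\<close>
  have "\<forall>K\<in>?Z. \<exists>J. normalised a r d (fst J) (fst (snd J)) (snd (snd J)) \<and> K = zero_set ?D (fst J)"
  proof
    fix K assume K: "K \<in> ?Z"
    obtain F G G' where "normalised a r d F G G'" "K = zero_set ?D F"
      by (rule zero_sets_normalised[OF r \<kappa>0 K, folded d_def])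
    then show "\<exists>J. normalised a r d (fst J) (fst (snd J)) (snd (snd J)) \<and> K = zero_set ?D (fst J)"
      by (intro exI[of _ "(F, G, G')"]) simp
  qed
  then obtain J where J: "\<forall>K\<in>?Z. normalised a r d (fst (J K)) (fst (snd (J K))) (snd (snd (J K)))
      \<and> K = zero_set ?D (fst (J K))"
    by (rule bchoice[THEN exE])
  have J1: "normalised a r d (fst (J K)) (fst (snd (J K))) (snd (snd (J K)))"
    and J2: "zero_set ?D (fst (J K)) = K" if "K \<in> ?Z" for K
    by (rule conjunct1[OF bspec[OF J that]], rule conjunct2[OF bspec[OF J that], symmetric])
  define code where "code K = jet_code a r e (fst (J K)) (fst (snd (J K)))" for K
  have sub: "?Z \<subseteq> Pow ?D" unfolding zero_sets_def zero_set_def by blast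
  have codes: "code ` ?Z \<subseteq> jet_codes a r e"
    unfolding code_def by (intro image_subsetI jet_code_in[OF J1 e01(1)])
  have rel: "(K, L) \<in> rigid_isotopy ?D" if "K \<in> ?Z" "L \<in> ?Z" "code K = code L" for K L
  proof -
    have "jet_code a r e (fst (J L)) (fst (snd (J L))) = jet_code a r e (fst (J K)) (fst (snd (J K)))"
      using that(3) by (simp add: code_def)
    note close = same_jet_code_imp_close[OF J1[OF that(2)] J1[OF that(1)] d ed this]
    have "close_equations a r d (fst (J L)) (fst (J K)) (fst (snd (J L))) (fst (snd (J K)))
        (snd (snd (J L))) (snd (snd (J K)))"
      by (rule close_equations.intro[OF r d J1[OF that(2)] J1[OF that(1)] close])
    then have "(zero_set ?D (fst (J K)), zero_set ?D (fst (J L))) \<in> rigid_isotopy ?D"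
      by (rule close_equations.rigidly_isotopic)
    then show ?thesis by (simp only: J2[OF that(1)] J2[OF that(2)])
  qed
  note card = card_quotient_le_code[OF equiv_rigid_isotopy sub jet_codes_finite[OF e01 r] codes rel]
  show "finite (isotopy_classes a r \<kappa>)" unfolding isotopy_classes_def by (rule card(1))
  have "real (card (isotopy_classes a r \<kappa>)) \<le> real (card (jet_codes a r e))"
    unfolding isotopy_classes_def by (rule of_nat_mono[OF card(2)])
  also have "\<dots> \<le> (5 / e\<^sup>2) ^ ((CARD('n) + 1) * card (cell a e ` ?D))"
    by (rule card_jet_codes[OF e01 r])
  finally show "real (card (isotopy_classes a r \<kappa>)) \<le> (5 / e\<^sup>2) ^ ((CARD('n) + 1) * card (cell a e ` ?D))" .
qed

text \<open>Classes are formed among all subsets of the disk, not among the zero sets alone, so a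
  larger bound adds classes without altering those already present.\<close>

lemma isotopy_classes_mono:
  assumes "\<kappa> \<le> \<kappa>'"
  shows "isotopy_classes a r \<kappa> \<subseteq> isotopy_classes a r \<kappa>'"
proof -
  have "zero_sets a r \<kappa> \<subseteq> zero_sets a r \<kappa>'" using assms unfolding zero_sets_def by force
  then show ?thesis unfolding isotopy_classes_def quotient_def by blast
qed

theorem theorem7:
  fixes a :: "real^'n" and r :: real
  assumes "r > 0"
  shows "\<exists>C1 C2 :: real. \<forall>\<kappa>::real. \<kappa> > 0 \<longrightarrow>
           finite (isotopy_classes a r \<kappa>) \<and>
           real (card (isotopy_classes a r \<kappa>))
             \<le> max C1 (\<kappa> powr (C2 * \<kappa> ^ (CARD('n) + 1)))"
proof -
  let ?n = "CARD('n)"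
  define b where "b = 1200 * real ?n ^ 3"
  have b: "b > 0" by (simp add: b_def)
  \<comment> \<open>For \<open>\<kappa> \<ge> 2\<close> the constant \<open>5 * b\<^sup>2\<close> is
    swallowed by \<open>\<kappa> ^ q\<close>, which makes the base \<open>5 / e\<^sup>2\<close> at
    most a pure power of \<open>\<kappa>\<close>.\<close>
  obtain q :: nat where q: "5 * b\<^sup>2 < 2 ^ q" using real_arch_pow[of 2 "5 * b\<^sup>2"] by auto
  define A where "A = ((2 * r + 3) * b) ^ ?n"
  have A: "A \<ge> 0" using assms b by (simp add: A_def)
  define C2 where "C2 = real (q + 2) * real (?n + 1) * A"
  \<comment> \<open>For \<open>\<kappa> \<le> 1\<close> the power is at most 1 and useless; by
    monotonicity the count at 2 serves for all \<open>\<kappa> \<le> 2\<close>.\<close>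
  define C1 where "C1 = real (card (isotopy_classes a r 2))"
  have "finite (isotopy_classes a r \<kappa>) \<and>
      real (card (isotopy_classes a r \<kappa>)) \<le> max C1 (\<kappa> powr (C2 * \<kappa> ^ (?n + 1)))" for \<kappa> :: real
  proof (cases "\<kappa> \<le> 2")
    case True
    note sub = isotopy_classes_mono[OF True, of a r]
    have fin: "finite (isotopy_classes a r 2)" by (rule isotopy_classes_bound(1)[OF assms _ refl]) simp
    have "real (card (isotopy_classes a r \<kappa>)) \<le> C1" unfolding C1_def using card_mono[OF fin sub] by simp
    with finite_subset[OF sub fin] show ?thesis by (simp add: max.coboundedI1)
  next
    case False
    then have \<kappa>: "\<kappa> \<ge> 2" by simp
    define e where "e = 1 / (1200 * real ?n ^ 3 * \<kappa>)"
    have e: "1 / e = b * \<kappa>" by (simp add: e_def b_def)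
    have be: "b * \<kappa> \<ge> 1"
    proof -
      have "1 \<le> real ?n ^ 3" by (intro one_le_power) (simp add: Suc_leI)
      then have "1 \<le> b" unfolding b_def by linarith
      then show ?thesis using mult_mono[of 1 b 1 \<kappa>] \<kappa> by simp
    qed
    have e01: "0 < e" "e \<le> 1"
    proof -
      show "0 < e" using \<kappa> by (simp add: e_def)
      then show "e \<le> 1" using be unfolding e[symmetric] by (simp add: le_divide_eq_1_pos)
    qed
    define E where "E = card (cell a e ` cball a r)"
    note bound = isotopy_classes_bound[of r \<kappa> e a, OF assms _ e_def, folded E_def]
    have "5 / e\<^sup>2 = (5 * b\<^sup>2) * \<kappa>\<^sup>2"
    proof -
      have "5 / e\<^sup>2 = 5 * (1 / e)\<^sup>2" by (simp add: power_divide)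
      then show ?thesis unfolding e by (simp add: power_mult_distrib)
    qed
    also have "\<dots> \<le> \<kappa> ^ q * \<kappa>\<^sup>2"
    proof (rule mult_right_mono)
      have "2 ^ q \<le> \<kappa> ^ q" using \<kappa> by (intro power_mono) auto
      then show "5 * b\<^sup>2 \<le> \<kappa> ^ q" using q by simp
    qed simp
    finally have base: "5 / e\<^sup>2 \<le> \<kappa> ^ (q + 2)" by (simp only: power_add)
    have "real E \<le> ((2 * r + 3) / e) ^ ?n"
      unfolding E_def by (rule cells_of_cball(2)[OF e01 assms])
    also have "\<dots> = A * \<kappa> ^ ?n"
    proof -
      have "(2 * r + 3) / e = (2 * r + 3) * (1 / e)" by simp
      then show ?thesis unfolding e by (simp add: A_def power_mult_distrib mult_ac)
    qed
    \<comment> \<open>The grid yields only \<open>\<kappa> ^ ?n\<close>; the exponent of the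
      statement leaves room for one more factor.\<close>
    also have "\<dots> \<le> A * \<kappa> ^ (?n + 1)" using A \<kappa> by (intro mult_left_mono power_increasing) auto
    finally have E: "real E \<le> A * \<kappa> ^ (?n + 1)" .
    have "real (card (isotopy_classes a r \<kappa>)) \<le> (5 / e\<^sup>2) ^ ((?n + 1) * E)"
      using bound(2) \<kappa> by simp
    also have "\<dots> \<le> (\<kappa> ^ (q + 2)) ^ ((?n + 1) * E)" by (intro power_mono base) simp
    also have "\<dots> = \<kappa> powr real ((q + 2) * ((?n + 1) * E))"
      using \<kappa> by (simp only: power_mult[symmetric] powr_realpow)
    also have "\<dots> \<le> \<kappa> powr (C2 * \<kappa> ^ (?n + 1))"
    proof (rule powr_mono)
      have "real ((q + 2) * ((?n + 1) * E)) = real (q + 2) * real (?n + 1) * real E"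
        by (simp only: of_nat_mult mult.assoc)
      also have "\<dots> \<le> real (q + 2) * real (?n + 1) * (A * \<kappa> ^ (?n + 1))"
        by (intro mult_left_mono E) simp
      finally show "real ((q + 2) * ((?n + 1) * E)) \<le> C2 * \<kappa> ^ (?n + 1)"
        by (simp only: C2_def mult.assoc)
    qed (use \<kappa> in simp)
    finally show ?thesis using bound(1) \<kappa> by (simp add: max.coboundedI2)
  qed
  then show ?thesis by blast
qed

end
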